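(* Let $G$ be a finitely generated and infinite group with decidable word problem. The class of Medvedev degrees of nonempty effective subshifts on $G$ (over arbitrary finite alphabets) is the class of all $\Pi^0_1$ Medvedev degrees.
   Context: Let $S$ be a finite generating set of $G$; for $w\in(S\cup S^{-1})^*$, $w_G$ is the corresponding element of $G$. Decidable word problem means $\{w\mid w_G=1_G\}$ is decidable. Subshifts. Let $A$ be a finite alphabet; $A^G$ has the prodiscrete topology. A subshift on $G$ is a closed subset $X\subset A^G$ invariant under the action $(gx)(h)=x(g^{-1}h)$. A pattern is a function $p\colon K\to A$ with $K\subset G$ finite; it appears in $x$ if $(gx)|_K=p$ for some $g\in G$. A pattern coding is a finite set of tuples $c=\{(w_1,a_1),\dots,(w_k,a_k)\}$ with $w_i\in(S\cup S^{-1})^*$, $a_i\in A$; it is consistent if $(w_i)_G=(w_j)_G$ implies $a_i=a_j$, and then it defines the pattern $p(c)$ with support $\{(w_1)_G,\dots,(w_k)_G\}$ and $p(c)((w_i)_G)=a_i$. A set $\mathcal{C}$ of pattern codings defines the subshift $X_{\mathcal{C}}$ of all $x\in A^G$ in which no pattern $p(c)$, $c\in\mathcal{C}$ consistent, appears. A subshift $X$ is effective if $X=X_{\mathcal{C}}$ for some computably enumerable set $\mathcal{C}$ of pattern codings. Computability on $A^{\mathbb{N}}$. A partial function $F\colon D\subset A^{\mathbb{N}}\to B^{\mathbb{N}}$ is computable if there is a partial computable function $f\colon A^*\to B^*$, monotone for the prefix order, such that for every $x\in D$ the words $f(x|_{\{0,\dots,k\}})$ are prefixes of $F(x)$ whose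 lengths tend to infinity with $k$. A set $X\subset A^{\mathbb{N}}$ is effectively closed, or $\Pi^0_1$, if its complement is $\bigcup_{w\in L}[w]$ for a computably enumerable $L\subset A^*$, where $[w]$ is the set of sequences with prefix $w$. Medvedev degrees. For $X\subset A^{\mathbb{N}}$, $Y\subset B^{\mathbb{N}}$ ($A,B$ finite), $Y\leq_{\mathfrak{M}}X$ means that there is a partial computable function $\Phi$ defined on all elements of $X$ with $\Phi(X)\subset Y$; $X\equiv_{\mathfrak{M}}Y$ means both reductions hold. Medvedev degrees are the equivalence classes of $\equiv_{\mathfrak{M}}$, and $\deg_{\mathfrak{M}}(X)$ is the class of $X$. A Medvedev degree is $\Pi^0_1$ if it is the degree of a nonempty $\Pi^0_1$ subset of $\{0,1\}^{\mathbb{N}}$. Degrees of subsets of $A^G$. Let $\nu\colon\mathbb{N}\to G$ be a bijection making the group operation of $G$ computable (it exists, and all such are equivalent up to a computable bijection of $\mathbb{N}$, since $G$ is infinite with decidable word problem), and let $\delta\colon A^{\mathbb{N}}\to A^G$, $\delta(x)=x\circ\nu^{-1}$. For $X\subset A^G$ put $\deg_{\mathfrak{M}}(X)=\deg_{\mathfrak{M}}(\delta^{-1}(X))$; this does not depend on $\nu$. *)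

theory Defs
  imports
    "HOL-Library.Nat_Bijection"
    "HOL-Library.Sublist"
    "HOL-Analysis.Function_Topology"
    "HOL-Algebra.Generated_Groups"
begin

section \<open>Partial recursive functions\<close>

definition minimise :: "(nat \<Rightarrow> nat option) \<Rightarrow> nat option" where
  "minimise h =
    (if \<exists>n. h n = Some 0 \<and> (\<forall>m<n. h m \<noteq> None) then Some (LEAST n. h n = Some 0) else None)"

text \<open>Unary partial recursive functions; several arguments are passed through the
  pairing function \<^const>\<open>prod_encode\<close>, and \<^const>\<open>None\<close> means divergence.\<close>

inductive partrec :: "(nat \<Rightarrow> nat option) \<Rightarrow> bool" where
  zero: "partrec (\<lambda>n. Some 0)"
| succ: "partrec (\<lambda>n. Some (Suc n))"
| left: "partrec (\<lambda>n. Some (fst (prod_decode n)))"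
| right: "partrec (\<lambda>n. Some (snd (prod_decode n)))"
| pair: "partrec f \<Longrightarrow> partrec g \<Longrightarrow>
    partrec (\<lambda>n. Option.bind (f n) (\<lambda>a. Option.bind (g n) (\<lambda>b. Some (prod_encode (a, b)))))"
| comp: "partrec f \<Longrightarrow> partrec g \<Longrightarrow> partrec (\<lambda>n. Option.bind (g n) f)"
| prec: "partrec f \<Longrightarrow> partrec g \<Longrightarrow>
    partrec (\<lambda>n. case prod_decode n of (a, k) \<Rightarrow>
      rec_nat (f a)
        (\<lambda>i r. Option.bind r (\<lambda>v. g (prod_encode (a, prod_encode (i, v))))) k)"
| mu: "partrec f \<Longrightarrow> partrec (\<lambda>a. minimise (\<lambda>n. f (prod_encode (a, n))))"

definition comp_enumerable :: "nat set \<Rightarrow> bool" where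
  "comp_enumerable M \<longleftrightarrow> (\<exists>f. partrec f \<and> M = {n. f n \<noteq> None})"

definition decidable_set :: "nat set \<Rightarrow> bool" where
  "decidable_set M \<longleftrightarrow> partrec (\<lambda>n. Some (if n \<in> M then 1 else 0))"

definition partrec_words :: "(nat list \<Rightarrow> nat list option) \<Rightarrow> bool" where
  "partrec_words f \<longleftrightarrow> partrec (\<lambda>n. map_option list_encode (f (list_decode n)))"

section \<open>Computability on sequences over a finite alphabet\<close>

text \<open>Alphabets are finite sets of natural numbers.\<close>

definition seqs :: "nat set \<Rightarrow> (nat \<Rightarrow> nat) set" where
  "seqs A = {x. range x \<subseteq> A}"

definition prefix_of_seq :: "nat list \<Rightarrow> (nat \<Rightarrow> nat) \<Rightarrow> bool" where
  "prefix_of_seq w x \<longleftrightarrow> w = map x [0..<length w]"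

definition cylinder :: "nat set \<Rightarrow> nat list \<Rightarrow> (nat \<Rightarrow> nat) set" where
  "cylinder A w = {x \<in> seqs A. prefix_of_seq w x}"

definition effectively_closed :: "nat set \<Rightarrow> (nat \<Rightarrow> nat) set \<Rightarrow> bool" where
  "effectively_closed A X \<longleftrightarrow> X \<subseteq> seqs A \<and>
    (\<exists>L \<subseteq> lists A. comp_enumerable (list_encode ` L) \<and> seqs A - X = (\<Union>w\<in>L. cylinder A w))"

text \<open>\<open>F\<close> is regarded as a partial function with domain \<open>D\<close>; its values outside \<open>D\<close>
  are irrelevant.\<close>

definition computable_on ::
  "nat set \<Rightarrow> nat set \<Rightarrow> (nat \<Rightarrow> nat) set \<Rightarrow> ((nat \<Rightarrow> nat) \<Rightarrow> (nat \<Rightarrow> nat)) \<Rightarrow> bool" where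
  "computable_on A B D F \<longleftrightarrow> D \<subseteq> seqs A \<and> F ` D \<subseteq> seqs B \<and>
    (\<exists>f. partrec_words f \<and> dom f \<subseteq> lists A \<and> ran f \<subseteq> lists B \<and>
      (\<forall>u\<in>dom f. \<forall>v\<in>dom f. prefix u v \<longrightarrow> prefix (the (f u)) (the (f v))) \<and>
      (\<forall>x\<in>D.
        (\<forall>k. map x [0..<Suc k] \<in> dom f \<and>
             prefix_of_seq (the (f (map x [0..<Suc k]))) (F x)) \<and>
        filterlim (\<lambda>k. length (the (f (map x [0..<Suc k])))) at_top sequentially))"

section \<open>Medvedev degrees\<close>

definition medvedev_le :: "(nat \<Rightarrow> nat) set \<Rightarrow> (nat \<Rightarrow> nat) set \<Rightarrow> bool" where
  "medvedev_le Y X \<longleftrightarrow>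
    (\<exists>A B. finite A \<and> finite B \<and> X \<subseteq> seqs A \<and> Y \<subseteq> seqs B \<and>
      (\<exists>D F. X \<subseteq> D \<and> computable_on A B D F \<and> F ` X \<subseteq> Y))"

definition medvedev_equiv :: "(nat \<Rightarrow> nat) set \<Rightarrow> (nat \<Rightarrow> nat) set \<Rightarrow> bool" where
  "medvedev_equiv X Y \<longleftrightarrow> medvedev_le X Y \<and> medvedev_le Y X"

definition medvedev_degree :: "(nat \<Rightarrow> nat) set \<Rightarrow> (nat \<Rightarrow> nat) set set" where
  "medvedev_degree X = {Y. medvedev_equiv X Y}"

definition Pi01_degree :: "(nat \<Rightarrow> nat) set set \<Rightarrow> bool" where
  "Pi01_degree d \<longleftrightarrow> (\<exists>P. P \<noteq> {} \<and> effectively_closed {0, 1} P \<and> d = medvedev_degree P)"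

section \<open>Words and the word problem\<close>

definition letters :: "('g, 'b) monoid_scheme \<Rightarrow> 'g set \<Rightarrow> 'g set" where
  "letters G S = S \<union> m_inv G ` S"

definition word_value :: "('g, 'b) monoid_scheme \<Rightarrow> 'g list \<Rightarrow> 'g" where
  "word_value G w = foldr (mult G) w (one G)"

text \<open>Letters are numbered by an injection \<open>e\<close>. As \<open>letters G S\<close> is finite, changing \<open>e\<close>
  is a computable recoding, so the choice of \<open>e\<close> affects neither this notion nor
  \<open>comp_enumerable_codings\<close> below.\<close>

definition decidable_word_problem :: "('g, 'b) monoid_scheme \<Rightarrow> 'g set \<Rightarrow> bool" where
  "decidable_word_problem G S \<longleftrightarrow>
    (\<exists>e :: 'g \<Rightarrow> nat. inj_on e (letters G S) \<and>
      decidable_set ((\<lambda>w. list_encode (map e w)) `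
        {w \<in> lists (letters G S). word_value G w = one G}))"

section \<open>Effective subshifts\<close>

definition configs :: "('g, 'b) monoid_scheme \<Rightarrow> nat set \<Rightarrow> ('g \<Rightarrow> nat) topology" where
  "configs G A = product_topology (\<lambda>_. discrete_topology A) (carrier G)"

definition shift :: "('g, 'b) monoid_scheme \<Rightarrow> 'g \<Rightarrow> ('g \<Rightarrow> nat) \<Rightarrow> 'g \<Rightarrow> nat" where
  "shift G g x = (\<lambda>h\<in>carrier G. x (mult G (m_inv G g) h))"

definition subshift :: "('g, 'b) monoid_scheme \<Rightarrow> nat set \<Rightarrow> ('g \<Rightarrow> nat) set \<Rightarrow> bool" where
  "subshift G A X \<longleftrightarrow> closedin (configs G A) X \<and> (\<forall>g\<in>carrier G. \<forall>x\<in>X. shift G g x \<in> X)"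

text \<open>A pattern is a partial map; its support is its domain.\<close>

definition appears :: "('g, 'b) monoid_scheme \<Rightarrow> ('g \<rightharpoonup> nat) \<Rightarrow> ('g \<Rightarrow> nat) \<Rightarrow> bool" where
  "appears G p x \<longleftrightarrow> (\<exists>g\<in>carrier G. (Some \<circ> shift G g x) |` dom p = p)"

type_synonym 'g coding = "('g list \<times> nat) set"

definition pattern_codings ::
  "('g, 'b) monoid_scheme \<Rightarrow> 'g set \<Rightarrow> nat set \<Rightarrow> 'g coding set" where
  "pattern_codings G S A = {c. finite c \<and> c \<subseteq> lists (letters G S) \<times> A}"

definition consistent :: "('g, 'b) monoid_scheme \<Rightarrow> 'g coding \<Rightarrow> bool" where
  "consistent G c \<longleftrightarrow>
    (\<forall>(v, a)\<in>c. \<forall>(w, b)\<in>c. word_value G v = word_value G w \<longrightarrow> a = b)"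

definition coded_pattern :: "('g, 'b) monoid_scheme \<Rightarrow> 'g coding \<Rightarrow> ('g \<rightharpoonup> nat)" where
  "coded_pattern G c = (\<lambda>h.
    if h \<in> word_value G ` fst ` c then Some (THE a. \<exists>w. (w, a) \<in> c \<and> word_value G w = h)
    else None)"

definition subshift_of ::
  "('g, 'b) monoid_scheme \<Rightarrow> nat set \<Rightarrow> 'g coding set \<Rightarrow> ('g \<Rightarrow> nat) set" where
  "subshift_of G A C =
    {x \<in> carrier G \<rightarrow>\<^sub>E A. \<forall>c\<in>C. consistent G c \<longrightarrow> \<not> appears G (coded_pattern G c) x}"

definition coding_encode :: "('g \<Rightarrow> nat) \<Rightarrow> 'g coding \<Rightarrow> nat" where
  "coding_encode e c =
    set_encode ((\<lambda>(w, a). prod_encode (list_encode (map e w), a)) ` c)"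

definition comp_enumerable_codings ::
  "('g, 'b) monoid_scheme \<Rightarrow> 'g set \<Rightarrow> 'g coding set \<Rightarrow> bool" where
  "comp_enumerable_codings G S C \<longleftrightarrow>
    (\<exists>e. inj_on e (letters G S) \<and> comp_enumerable (coding_encode e ` C))"

definition effective_subshift ::
  "('g, 'b) monoid_scheme \<Rightarrow> 'g set \<Rightarrow> nat set \<Rightarrow> ('g \<Rightarrow> nat) set \<Rightarrow> bool" where
  "effective_subshift G S A X \<longleftrightarrow> subshift G A X \<and>
    (\<exists>C \<subseteq> pattern_codings G S A. comp_enumerable_codings G S C \<and> X = subshift_of G A C)"

section \<open>Medvedev degrees of sets of configurations\<close>

definition computable_numbering :: "('g, 'b) monoid_scheme \<Rightarrow> (nat \<Rightarrow> 'g) \<Rightarrow> bool" where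
  "computable_numbering G \<nu> \<longleftrightarrow> bij_betw \<nu> UNIV (carrier G) \<and>
    partrec (\<lambda>n. case prod_decode n of (i, j) \<Rightarrow> Some (inv_into UNIV \<nu> (mult G (\<nu> i) (\<nu> j))))"

definition delta :: "('g, 'b) monoid_scheme \<Rightarrow> (nat \<Rightarrow> 'g) \<Rightarrow> (nat \<Rightarrow> nat) \<Rightarrow> 'g \<Rightarrow> nat" where
  "delta G \<nu> x = restrict (x \<circ> inv_into UNIV \<nu>) (carrier G)"

text \<open>Computable numberings exist for infinite finitely generated groups with decidable word
  problem, and the degree does not depend on the one chosen. If \<open>X\<close> is a set of
  configurations over \<open>A\<close> then the preimage is contained in \<open>seqs A\<close>, because
  \<open>\<nu>\<close> is onto \<open>carrier G\<close>.\<close>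

definition config_degree ::
  "('g, 'b) monoid_scheme \<Rightarrow> ('g \<Rightarrow> nat) set \<Rightarrow> (nat \<Rightarrow> nat) set set" where
  "config_degree G X =
    medvedev_degree (delta G (SOME \<nu>. computable_numbering G \<nu>) -` X)"

end

theory Submission
  imports Defs "HOL-Library.More_List"
begin

text \<open>
Number the group by a computable bijection \<open>\<nu>\<close> with the natural numbers
(\<open>computable_numbering_exists\<close>). Configurations then become sequences, and the group operation
becomes a computable operation on \<^typ>\<open>nat\<close>.

An occurrence of a forbidden pattern is visible in a finite prefix of the sequence, and the number of
an element given by a word is computable. So an effective subshift becomes an effectively closed
set of sequences (\<open>effective_subshift_vimage_effectively_closed\<close>), and a block code replaces its
alphabet by \<open>{0, 1}\<close> (\<open>effectively_closed_binary_degree\<close>). This is one inclusion.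

For the other one, let \<open>P\<close> be a nonempty effectively closed set of binary sequences. The idea is to
write every sequence \<open>y\<close> all over the group, in such a way that it can be read from any position
without knowing where one is. That is, there are computable functionals \<open>inscribe\<close>, from binary
sequences to configurations, and \<open>recover\<close>, defined on all configurations, such that
\<open>recover\<close> applied to any translate of \<open>inscribe y\<close> returns \<open>y\<close> (\<open>recover_inscribe\<close>). Then the set of
all \<open>x\<close> such that \<open>recover\<close> maps every translate of \<open>x\<close> into \<open>P\<close> is invariant by definition and
effectively closed because \<open>recover\<close> has a computable modulus of continuity. It is therefore an
effective subshift (\<open>effective_subshift_of_words\<close>). The map \<open>inscribe\<close> reduces it to \<open>P\<close>, the map
\<open>recover\<close> reduces \<open>P\<close> to it, and the two sets have the same degree.

The functionals rest on a decreasing sequence of nets in the group, the first one being the whole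
group. Each net is a maximal separated subset of the one before, at a scale that grows quickly.
The \<open>n\<close>-th layer consists of the points of the \<open>n\<close>-th net that are not in the next one. It meets every
translate of a certain finite set, and each of its points carries the value \<open>y n\<close>. With finitely
many symbols a cell cannot name its layer. Instead, the points of layer \<open>n\<close> near a point \<open>c\<close> of the
net \<open>n + 1\<close> carry a flag that tells whether \<open>c\<close> belongs to the net \<open>n + 2\<close>. As the net \<open>n + 1\<close> is
separated, the cell knows which \<open>c\<close> is meant. So the nets can be recognised one after the other
from the symbols in a finite window (\<open>net_Suc_Suc_iff\<close>), at any position of the group.

Computability of concrete functions is derived by resolution with the rules \<open>comp_intros\<close> for total
functions between encoded types. Enumerable sets are projections of computable relations
(\<open>comp_enumerable_iff\<close>).
\<close>

section \<open>Total computable functions on encoded data\<close>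

class enc =
  fixes enc :: "'a \<Rightarrow> nat"
  assumes enc_eq_iff [simp]: "enc x = enc y \<longleftrightarrow> x = y"

instantiation nat :: enc
begin
definition enc_nat :: "nat \<Rightarrow> nat" where [simp]: "enc_nat n = n"
instance by standard simp
end

instantiation bool :: enc
begin
definition enc_bool :: "bool \<Rightarrow> nat" where [simp]: "enc_bool b = of_bool b"
instance by standard simp
end

instantiation prod :: (enc, enc) enc
begin
definition enc_prod :: "'a \<times> 'b \<Rightarrow> nat" where
  [simp]: "enc_prod p = prod_encode (enc (fst p), enc (snd p))"
instance by standard (auto simp: prod_eq_iff)
end

instantiation option :: (enc) enc
begin
definition enc_option :: "'a option \<Rightarrow> nat" where
  [simp]: "enc_option p = (case p of None \<Rightarrow> 0 | Some a \<Rightarrow> Suc (enc a))"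
instance by standard (auto split: option.splits)
end

instantiation list :: (enc) enc
begin
definition enc_list :: "'a list \<Rightarrow> nat" where
  "enc_list xs = list_encode (map enc xs)"
instance
  by standard (auto simp: enc_list_def list_encode_eq inj_on_def dest: map_injective)
end

lemma enc_Nil [simp]: "enc [] = 0"
  and enc_Cons [simp]: "enc (x # xs) = Suc (prod_encode (enc x, enc xs))"
  by (simp_all add: enc_list_def)

lemma enc_nat_list: "enc (xs :: nat list) = list_encode xs"
  by (simp add: enc_list_def map_idI)

text \<open>The witness may be partial outside the codes of arguments. This is what makes
  unbounded search compositional: a search that succeeds for every argument may still diverge
  on a number that encodes no argument.\<close>

definition computable :: "('a::enc \<Rightarrow> 'b::enc) \<Rightarrow> bool" where
  "computable f \<longleftrightarrow> (\<exists>\<phi>. partrec \<phi> \<and> (\<forall>x. \<phi> (enc x) = Some (enc (f x))))"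

named_theorems comp_intros

lemma computableI: "partrec \<phi> \<Longrightarrow> (\<And>x. \<phi> (enc x) = Some (enc (f x))) \<Longrightarrow> computable f"
  unfolding computable_def by blast

lemma computableE:
  assumes "computable f"
  obtains \<phi> where "partrec \<phi>" "\<And>x. \<phi> (enc x) = Some (enc (f x))"
  using assms unfolding computable_def by blast

lemma computable_imp_partrec:
  fixes f :: "nat \<Rightarrow> nat"
  shows "computable f \<Longrightarrow> partrec (\<lambda>n. Some (f n))"
proof (erule computableE)
  fix \<phi> assume "partrec \<phi>" "\<And>x. \<phi> (enc x) = Some (enc (f x))"
  moreover from this have "\<phi> = (\<lambda>n. Some (f n))" by (intro ext) simp
  ultimately show ?thesis by simp
qed

lemma partrec_imp_computable: "partrec (\<lambda>n. Some (f n)) \<Longrightarrow> computable f"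
  by (erule computableI) simp

lemma computable_compose:
  assumes "computable f" "computable g"
  shows "computable (\<lambda>x. f (g x))"
proof -
  obtain \<phi> \<psi> where "partrec \<phi>" "\<And>x. \<phi> (enc x) = Some (enc (f x))"
    "partrec \<psi>" "\<And>x. \<psi> (enc x) = Some (enc (g x))"
    by (rule computableE[OF assms(1)], rule computableE[OF assms(2)]) blast
  then show ?thesis by (intro computableI[OF partrec.comp[of \<phi> \<psi>]]) auto
qed

lemma computable_id [comp_intros]: "computable (\<lambda>x. x)"
proof (rule computableI)
  show "partrec (\<lambda>n. Option.bind (Some (fst (prod_decode n)))
      (\<lambda>a. Option.bind (Some (snd (prod_decode n))) (\<lambda>b. Some (prod_encode (a, b)))))"
    by (intro partrec.pair partrec.left partrec.right)
qed simp

lemma computable_const [comp_intros]: "computable (\<lambda>x. c)"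
proof -
  have "partrec (\<lambda>_. Some n)" for n
  proof (induction n)
    case (Suc n)
    show ?case using partrec.comp[OF partrec.succ Suc] by simp
  qed (rule partrec.zero)
  then show ?thesis by (rule computableI[of "\<lambda>_. Some (enc c)"]) simp
qed

lemma computable_pair [comp_intros]:
  assumes "computable f" "computable g"
  shows "computable (\<lambda>x. (f x, g x))"
proof -
  obtain \<phi> \<psi> where "partrec \<phi>" "\<And>x. \<phi> (enc x) = Some (enc (f x))"
    "partrec \<psi>" "\<And>x. \<psi> (enc x) = Some (enc (g x))"
    by (rule computableE[OF assms(1)], rule computableE[OF assms(2)]) blast
  then show ?thesis by (intro computableI[OF partrec.pair[of \<phi> \<psi>]]) auto
qed

lemma computable_fst [comp_intros]: "computable f \<Longrightarrow> computable (\<lambda>x. fst (f x))"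
  by (rule computable_compose[of fst]) (rule computableI[OF partrec.left], simp)

lemma computable_snd [comp_intros]: "computable f \<Longrightarrow> computable (\<lambda>x. snd (f x))"
  by (rule computable_compose[of snd]) (rule computableI[OF partrec.right], simp)

lemma computable_enc: "computable f \<Longrightarrow> computable (\<lambda>x. enc (f x))"
  by (auto elim!: computableE intro: computableI)

text \<open>The parameter of a binding operator becomes a component of a pair in the premise, so that
  the rules apply to each other by plain resolution.\<close>

lemma computable_rec_nat [comp_intros]:
  assumes "computable f" "computable (\<lambda>p. g (fst p) (fst (snd p)) (snd (snd p)))" "computable k"
  shows "computable (\<lambda>x. rec_nat (f x) (\<lambda>i r. g x i r) (k x))"
proof -
  obtain \<phi> \<psi> \<kappa> where *: "partrec \<phi>" "\<And>x. \<phi> (enc x) = Some (enc (f x))"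
    "partrec \<psi>" "\<And>p. \<psi> (enc p) = Some (enc (g (fst p) (fst (snd p)) (snd (snd p))))"
    "partrec \<kappa>" "\<And>x. \<kappa> (enc x) = Some (enc (k x))"
    by (rule computableE[OF assms(1)], rule computableE[OF assms(2)], rule computableE[OF assms(3)]) blast
  obtain \<iota> where \<iota>: "partrec \<iota>" "\<And>x::'a. \<iota> (enc x) = Some (enc x)"
    by (rule computableE[OF computable_id]) blast
  have **: "\<psi> (prod_encode (enc x, prod_encode (i, enc r))) = Some (enc (g x i r))" for x i r
    using *(4)[of "(x, i, r)"] by simp
  have rec: "rec_nat (\<phi> (enc x))
      (\<lambda>i r. Option.bind r (\<lambda>v. \<psi> (prod_encode (enc x, prod_encode (i, v))))) n =
      Some (enc (rec_nat (f x) (g x) n))" for x n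
    by (induction n) (simp_all add: * **)
  show ?thesis
    by (rule computableI[OF partrec.comp[OF partrec.prec[OF *(1,3)] partrec.pair[OF \<iota>(1) *(5)]]])
      (simp add: \<iota> * rec[unfolded *(2)])
qed

lemma computable_if [comp_intros]:
  assumes "computable b" "computable f" "computable g"
  shows "computable (\<lambda>x. if b x then f x else g x)"
proof -
  have "computable (\<lambda>x. rec_nat (g x) (\<lambda>_ _. f x) (enc (b x)))"
    by (intro comp_intros computable_enc computable_compose[OF assms(2)] assms)
  moreover have "(\<lambda>x. rec_nat (g x) (\<lambda>_ _. f x) (enc (b x))) = (\<lambda>x. if b x then f x else g x)"
    by auto
  ultimately show ?thesis by simp
qed

text \<open>The way from an operation of the library to a primitive recursion that computes it.\<close>

lemma computable_cong: "computable f \<Longrightarrow> (\<And>x. g x = f x) \<Longrightarrow> computable g"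
  by (metis ext)

lemma computable_not [comp_intros]: "computable b \<Longrightarrow> computable (\<lambda>x. \<not> b x)"
  by (rule computable_cong[OF computable_if[of b "\<lambda>_. False" "\<lambda>_. True"]])
    (auto intro: computable_const)

lemma computable_conj [comp_intros]:
  "computable b \<Longrightarrow> computable c \<Longrightarrow> computable (\<lambda>x. b x \<and> c x)"
  by (rule computable_cong[OF computable_if[of b c "\<lambda>_. False"]]) (auto intro: computable_const)

lemma computable_disj [comp_intros]:
  "computable b \<Longrightarrow> computable c \<Longrightarrow> computable (\<lambda>x. b x \<or> c x)"
  by (rule computable_cong[OF computable_if[of b "\<lambda>_. True" c]]) (auto intro: computable_const)

lemma computable_imp [comp_intros]:
  "computable b \<Longrightarrow> computable c \<Longrightarrow> computable (\<lambda>x. b x \<longrightarrow> c x)"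
  by (rule computable_cong[OF computable_if[of b c "\<lambda>_. True"]]) (auto intro: computable_const)

subsection \<open>Arithmetic\<close>

lemma computable_Suc [comp_intros]: "computable f \<Longrightarrow> computable (\<lambda>x. Suc (f x))"
  by (rule computable_compose[of Suc]) (rule computableI[OF partrec.succ], simp)

lemma computable_add [comp_intros]:
  assumes "computable f" "computable g" shows "computable (\<lambda>x. f x + g x :: nat)"
proof (rule computable_cong)
  show "computable (\<lambda>x. rec_nat (f x) (\<lambda>_ r. Suc r) (g x))"
    by (intro comp_intros assms)
  have "a + b = rec_nat a (\<lambda>_ r. Suc r) b" for a b :: nat
    by (induction b) auto
  then show "f x + g x = rec_nat (f x) (\<lambda>_ r. Suc r) (g x)" for x .
qed

lemma computable_mult [comp_intros]:
  assumes "computable f" "computable g" shows "computable (\<lambda>x. f x * g x :: nat)"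
proof (rule computable_cong)
  show "computable (\<lambda>x. rec_nat 0 (\<lambda>_ r. r + f x) (g x))"
    by (intro comp_intros computable_compose[OF assms(1)] assms(2))
  have "a * b = rec_nat 0 (\<lambda>_ r. r + a) b" for a b :: nat
    by (induction b) auto
  then show "f x * g x = rec_nat 0 (\<lambda>_ r. r + f x) (g x)" for x .
qed

lemma computable_power [comp_intros]:
  assumes "computable f" "computable g" shows "computable (\<lambda>x. f x ^ g x :: nat)"
proof (rule computable_cong)
  show "computable (\<lambda>x. rec_nat 1 (\<lambda>_ r. r * f x) (g x))"
    by (intro comp_intros computable_compose[OF assms(1)] assms(2))
  have "a ^ b = rec_nat 1 (\<lambda>_ r. r * a) b" for a b :: nat
    by (induction b) auto
  then show "f x ^ g x = rec_nat 1 (\<lambda>_ r. r * f x) (g x)" for x .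
qed

lemma computable_diff [comp_intros]:
  assumes "computable f" "computable g" shows "computable (\<lambda>x. f x - g x :: nat)"
proof (rule computable_cong)
  show "computable (\<lambda>x. rec_nat (f x) (\<lambda>_ r. rec_nat 0 (\<lambda>i _. i) r) (g x))"
    by (intro comp_intros assms)
  have "a - b = rec_nat a (\<lambda>_ r. rec_nat 0 (\<lambda>i _. i) r) b" for a b :: nat
  proof (induction b)
    case (Suc b)
    have "rec_nat 0 (\<lambda>i _. i) c = c - 1" for c :: nat by (cases c) auto
    with Suc show ?case by simp
  qed simp
  then show "f x - g x = rec_nat (f x) (\<lambda>_ r. rec_nat 0 (\<lambda>i _. i) r) (g x)" for x .
qed

lemma computable_le [comp_intros]:
  assumes "computable f" "computable g" shows "computable (\<lambda>x. f x \<le> (g x :: nat))"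
proof (rule computable_cong)
  show "computable (\<lambda>x. rec_nat True (\<lambda>_ _. False) (f x - g x))"
    by (intro comp_intros assms)
  show "f x \<le> g x \<longleftrightarrow> rec_nat True (\<lambda>_ _. False) (f x - g x)" for x
    by (cases "f x - g x") auto
qed

lemma computable_less [comp_intros]:
  "computable f \<Longrightarrow> computable g \<Longrightarrow> computable (\<lambda>x. f x < (g x :: nat))"
  unfolding less_eq_Suc_le by (intro comp_intros)

lemma computable_eq [comp_intros]:
  assumes "computable f" "computable g" shows "computable (\<lambda>x. f x = g x)"
proof (rule computable_cong)
  show "computable (\<lambda>x. enc (f x) \<le> enc (g x) \<and> enc (g x) \<le> enc (f x))"
    by (intro computable_conj computable_le computable_enc assms)
  show "f x = g x \<longleftrightarrow> enc (f x) \<le> enc (g x) \<and> enc (g x) \<le> enc (f x)" for x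
    by (metis enc_eq_iff le_antisym order_refl)
qed

lemma computable_mod [comp_intros]:
  assumes "computable f" "computable g" shows "computable (\<lambda>x. f x mod (g x :: nat))"
proof (rule computable_cong)
  show "computable (\<lambda>x. rec_nat 0 (\<lambda>_ r. if Suc r = g x then 0 else Suc r) (f x))"
    by (intro comp_intros computable_compose[OF assms(2)] assms)
  have "a mod b = rec_nat 0 (\<lambda>_ r. if Suc r = b then 0 else Suc r) a" for a b :: nat
    by (induction a) (auto simp: mod_Suc)
  then show "f x mod g x = rec_nat 0 (\<lambda>_ r. if Suc r = g x then 0 else Suc r) (f x)" for x .
qed

lemma computable_div [comp_intros]:
  assumes "computable f" "computable g" shows "computable (\<lambda>x. f x div (g x :: nat))"
proof (rule computable_cong)
  show "computable (\<lambda>x. rec_nat 0 (\<lambda>i r. if Suc i mod g x = 0 then Suc r else r) (f x))"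
    by (intro comp_intros computable_compose[OF assms(2)] assms)
  have "a div b = rec_nat 0 (\<lambda>i r. if Suc i mod b = 0 then Suc r else r) a" for a b :: nat
    by (induction a) (auto simp: div_Suc)
  then show "f x div g x = rec_nat 0 (\<lambda>i r. if Suc i mod g x = 0 then Suc r else r) (f x)" for x .
qed

lemma computable_even [comp_intros]: "computable f \<Longrightarrow> computable (\<lambda>x. even (f x :: nat))"
  unfolding even_iff_mod_2_eq_zero by (intro comp_intros)

lemma computable_ex_less [comp_intros]:
  fixes k :: "'a::enc \<Rightarrow> nat"
  assumes "computable (\<lambda>p. P (fst p) (snd p))" "computable k"
  shows "computable (\<lambda>x. \<exists>i<k x. P x i)"
proof (rule computable_cong)
  show "computable (\<lambda>x. rec_nat False (\<lambda>i r. r \<or> P x i) (k x))"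
    by (intro comp_intros assms(2)
      computable_compose[OF assms(1), of "\<lambda>p. (fst p, fst (snd p))", simplified])
  have "(\<exists>i<k. P x i) = rec_nat False (\<lambda>i r. r \<or> P x i) k" for x k
    by (induction k) (auto simp: less_Suc_eq)
  then show "(\<exists>i<k x. P x i) = rec_nat False (\<lambda>i r. r \<or> P x i) (k x)" for x .
qed

lemma computable_all_less [comp_intros]:
  fixes k :: "'a::enc \<Rightarrow> nat"
  assumes "computable (\<lambda>p. P (fst p) (snd p))" "computable k"
  shows "computable (\<lambda>x. \<forall>i<k x. P x i)"
  by (rule computable_cong[of "\<lambda>x. \<not> (\<exists>i<k x. \<not> P x i)"])
    (intro comp_intros assms, auto)

text \<open>Minimisation is total here because every argument has a witness, so a search may be nested
  inside all other constructions.\<close>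

lemma computable_Least:
  fixes P :: "'a::enc \<Rightarrow> nat \<Rightarrow> bool"
  assumes "computable (\<lambda>p. P (fst p) (snd p))" "\<And>x. \<exists>n. P x n"
  shows "computable (\<lambda>x. LEAST n. P x n)"
proof -
  have "computable (\<lambda>p. if P (fst p) (snd p) then 0 else 1 :: nat)"
    by (intro comp_intros assms)
  then obtain \<phi> where \<phi>: "partrec \<phi>"
    "\<And>p. \<phi> (enc p) = Some (if P (fst p) (snd p) then 0 else 1)"
    by (rule computableE) (simp only: enc_nat_def)
  have *: "\<phi> (prod_encode (enc x, n)) = Some (if P x n then 0 else 1)" for x n
    using \<phi>(2)[of "(x, n)"] by simp
  show ?thesis
    by (rule computableI[OF partrec.mu[OF \<phi>(1)]])
      (use assms(2) in \<open>auto simp: minimise_def *\<close>)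
qed

subsection \<open>Optional values\<close>

lemma computable_Some [comp_intros]: "computable f \<Longrightarrow> computable (\<lambda>x. Some (f x))"
proof -
  assume f: "computable f"
  obtain \<phi> where "partrec \<phi>" "\<And>x. \<phi> (enc x) = Some (Suc (enc (f x)))"
    by (rule computableE[OF computable_Suc[OF computable_enc[OF f]]]) (simp only: enc_nat_def)
  then show ?thesis by (intro computableI[of \<phi>]) auto
qed

text \<open>A case distinction on the code is a recursion whose step ignores the previous value.\<close>

lemma computable_case_code:
  fixes h :: "'a::enc \<Rightarrow> 'c::enc"
  assumes "computable c" "computable f" "computable (\<lambda>p. g (fst p) (snd p))"
    and zero: "\<And>x. c x = 0 \<Longrightarrow> h x = f x"
    and Suc: "\<And>x n. c x = Suc n \<Longrightarrow> \<exists>y. enc y = n \<and> h x = g x (y::'b::enc)"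
  shows "computable h"
proof -
  obtain \<phi> \<psi> \<kappa> where *: "partrec \<phi>" "\<And>x. \<phi> (enc x) = Some (enc (f x))"
    "partrec \<psi>" "\<And>p. \<psi> (enc p) = Some (enc (g (fst p) (snd p)))"
    "partrec \<kappa>" "\<And>x. \<kappa> (enc x) = Some (enc (c x))"
    by (rule computableE[OF assms(1)], rule computableE[OF assms(2)], rule computableE[OF assms(3)]) blast
  have **: "\<psi> (prod_encode (enc x, enc y)) = Some (enc (g x y))" for x y
    using *(4)[of "(x, y)"] by simp
  have "computable (\<lambda>x. (x, c x - 1))" "computable (\<lambda>x. if c x = 0 then 0 else 1 :: nat)"
    by (intro comp_intros assms)+
  then obtain \<pi> \<gamma> where \<pi>: "partrec \<pi>" "\<And>x. \<pi> (enc x) = Some (prod_encode (enc x, c x - 1))"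
    and \<gamma>: "partrec \<gamma>" "\<And>x. \<gamma> (enc x) = Some (if c x = 0 then 0 else 1)"
    by (auto elim!: computableE)
  obtain \<iota> where \<iota>: "partrec \<iota>" "\<And>x::'a. \<iota> (enc x) = Some (enc x)"
    by (rule computableE[OF computable_id]) blast
  show ?thesis
  proof (rule computableI[OF partrec.comp[OF partrec.prec[OF *(1)
          partrec.comp[OF partrec.comp[OF *(3) \<pi>(1)] partrec.left]] partrec.pair[OF \<iota>(1) \<gamma>(1)]]])
    fix x
    show "Option.bind (Option.bind (\<iota> (enc x)) (\<lambda>a. Option.bind (\<gamma> (enc x)) (\<lambda>b. Some (prod_encode (a, b)))))
      (\<lambda>n. case prod_decode n of (a, k) \<Rightarrow> rec_nat (\<phi> a)
        (\<lambda>i r. Option.bind r (\<lambda>v. Option.bind (Some (fst (prod_decode (prod_encode (a, prod_encode (i, v))))))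
            (\<lambda>n. Option.bind (\<pi> n) \<psi>))) k) = Some (enc (h x))"
      using zero[of x] Suc[of x "c x - 1"] by (cases "c x") (auto simp: * ** \<iota> \<gamma> \<pi>)
  qed
qed

lemma computable_case_option [comp_intros]:
  assumes "computable u" "computable f" "computable (\<lambda>p. g (fst p) (snd p))"
  shows "computable (\<lambda>x. case u x of None \<Rightarrow> f x | Some y \<Rightarrow> g x y)"
  by (rule computable_case_code[OF computable_enc[OF assms(1)] assms(2,3)])
    (auto split: option.splits)

lemma computable_bind [comp_intros]:
  assumes "computable u" "computable (\<lambda>p. g (fst p) (snd p))"
  shows "computable (\<lambda>x. Option.bind (u x) (\<lambda>y. g x y))"
proof (rule computable_cong)
  show "computable (\<lambda>x. case u x of None \<Rightarrow> None | Some y \<Rightarrow> g x y)"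
    by (intro comp_intros assms)
  show "Option.bind (u x) (\<lambda>y. g x y) = (case u x of None \<Rightarrow> None | Some y \<Rightarrow> g x y)" for x
    by (cases "u x") auto
qed

subsection \<open>Lists\<close>

lemma computable_Cons [comp_intros]:
  assumes "computable f" "computable g" shows "computable (\<lambda>x. f x # g x)"
proof -
  have "computable (\<lambda>x. Suc (enc (f x, g x)))"
    by (intro computable_Suc computable_enc computable_pair assms)
  then obtain \<phi> where "partrec \<phi>" "\<And>x. \<phi> (enc x) = Some (enc (Suc (enc (f x, g x))))"
    by (rule computableE) blast
  then show ?thesis by (intro computableI[of \<phi>]) auto
qed

lemma computable_case_list [comp_intros]:
  assumes "computable l" "computable f" "computable (\<lambda>p. g (fst p) (fst (snd p)) (snd (snd p)))"
  shows "computable (\<lambda>x. case l x of [] \<Rightarrow> f x | a # as \<Rightarrow> g x a as)"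
proof (rule computable_case_code[OF computable_enc[OF assms(1)] assms(2),
      where g = "\<lambda>x y. g x (fst y) (snd y)"])
  show "computable (\<lambda>p. g (fst p) (fst (snd p)) (snd (snd p)))" by fact
  show "\<exists>y. enc y = n \<and> (case l x of [] \<Rightarrow> f x | a # as \<Rightarrow> g x a as) = g x (fst y) (snd y)"
    if "enc (l x) = Suc n" for x n
    using that by (cases "l x") auto
  show "(case l x of [] \<Rightarrow> f x | a # as \<Rightarrow> g x a as) = f x" if "enc (l x) = 0" for x
    using that by (cases "l x") auto
qed

lemma length_le_enc: "length xs \<le> enc xs"
proof (induction xs)
  case (Cons x xs)
  also have "enc xs \<le> prod_encode (enc x, enc xs)" by (rule le_prod_encode_2)
  finally show ?case by simp
qed simp

text \<open>A fold is an iteration that consumes one element at each step; the code of the list bounds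
  the number of steps.\<close>

lemma computable_fold [comp_intros]:
  fixes g :: "'x::enc \<Rightarrow> 'a::enc \<Rightarrow> 's::enc \<Rightarrow> 's"
  assumes "computable (\<lambda>p. g (fst p) (fst (snd p)) (snd (snd p)))" "computable l" "computable s"
  shows "computable (\<lambda>x. fold (\<lambda>a r. g x a r) (l x) (s x))"
proof (rule computable_cong)
  define step where "step x q = (case fst q of [] \<Rightarrow> q | a # as \<Rightarrow> (as, g x a (snd q)))" for x q
  have "computable (\<lambda>p. g (fst p) (fst (snd p)) (snd (snd p)))" by fact
  from computable_compose[OF this, of "\<lambda>p. (fst (fst p), fst (snd p), snd (snd (snd (fst p))))"]
  have "computable (\<lambda>p :: ('x \<times> nat \<times> 'a list \<times> 's) \<times> 'a \<times> 'a list.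
      g (fst (fst p)) (fst (snd p)) (snd (snd (snd (fst p)))))"
    by (simp add: comp_intros)
  then show "computable (\<lambda>x. snd (rec_nat (l x, s x) (\<lambda>_ q. step x q) (enc (l x))))"
    unfolding step_def by (intro comp_intros computable_enc assms)
  have step_simps: "step x ([], r) = ([], r)" "step x (a # as, r) = (as, g x a r)" for x r a as
    by (simp_all add: step_def)
  have stop: "rec_nat ([], r) (\<lambda>_ q. step x q) n = ([], r)" for x r n
    by (induction n) (simp_all add: step_simps)
  have "length xs \<le> n \<Longrightarrow> rec_nat (xs, r) (\<lambda>_ q. step x q) n = ([], fold (g x) xs r)" for x xs r n
  proof (induction n arbitrary: xs r)
    case (Suc n)
    have shift: "rec_nat q (\<lambda>_ q. step x q) (Suc n) = rec_nat (step x q) (\<lambda>_ q. step x q) n" for q n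
      by (induction n) auto
    show ?case unfolding shift using Suc by (cases xs) (auto simp: step_simps stop)
  qed (simp add: stop)
  from this[OF length_le_enc]
  show "fold (\<lambda>a r. g x a r) (l x) (s x) = snd (rec_nat (l x, s x) (\<lambda>_ q. step x q) (enc (l x)))" for x
    by simp
qed

lemma computable_rev [comp_intros]: "computable l \<Longrightarrow> computable (\<lambda>x. rev (l x))"
  unfolding rev_conv_fold by (intro comp_intros)

lemma computable_append [comp_intros]:
  "computable l \<Longrightarrow> computable k \<Longrightarrow> computable (\<lambda>x. l x @ k x)"
  by (rule computable_cong[of "\<lambda>x. fold (#) (rev (l x)) (k x)"])
    (intro comp_intros, assumption+, simp add: fold_Cons_rev)

lemma computable_map [comp_intros]:
  assumes "computable (\<lambda>p. f (fst p) (snd p))" "computable l"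
  shows "computable (\<lambda>x. map (\<lambda>a. f x a) (l x))"
proof (rule computable_cong)
  show "computable (\<lambda>x. rev (fold (\<lambda>a r. f x a # r) (l x) []))"
    by (intro comp_intros assms(2)
      computable_compose[OF assms(1), of "\<lambda>p. (fst p, fst (snd p))", simplified])
  have "fold (\<lambda>a r. f x a # r) xs ys = rev (map (f x) xs) @ ys" for x xs ys
    by (induction xs arbitrary: ys) auto
  then show "map (\<lambda>a. f x a) (l x) = rev (fold (\<lambda>a r. f x a # r) (l x) [])" for x by simp
qed

lemma computable_length [comp_intros]:
  assumes "computable l" shows "computable (\<lambda>x. length (l x))"
proof (rule computable_cong)
  show "computable (\<lambda>x. fold (\<lambda>_ r. Suc r) (l x) 0)" by (intro comp_intros assms)
  have "fold (\<lambda>_ r. Suc r) xs n = length xs + n" for xs :: "'b list" and n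
    by (induction xs arbitrary: n) auto
  then show "length (l x) = fold (\<lambda>_ r. Suc r) (l x) 0" for x by simp
qed

lemma computable_foldr [comp_intros]:
  assumes "computable (\<lambda>p. g (fst p) (fst (snd p)) (snd (snd p)))" "computable l" "computable s"
  shows "computable (\<lambda>x. foldr (\<lambda>a r. g x a r) (l x) (s x))"
  unfolding foldr_conv_fold by (intro comp_intros assms)

lemma computable_upt [comp_intros]:
  assumes "computable f" shows "computable (\<lambda>x. [0..<f x])"
proof (rule computable_cong)
  show "computable (\<lambda>x. rec_nat [] (\<lambda>i r. r @ [i]) (f x))" by (intro comp_intros assms)
  have "[0..<n] = rec_nat [] (\<lambda>i r. r @ [i]) n" for n by (induction n) auto
  then show "[0..<f x] = rec_nat [] (\<lambda>i r. r @ [i]) (f x)" for x .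
qed

lemma computable_drop [comp_intros]:
  assumes "computable l" "computable f" shows "computable (\<lambda>x. drop (f x) (l x))"
proof (rule computable_cong)
  show "computable (\<lambda>x. rec_nat (l x) (\<lambda>_ r. case r of [] \<Rightarrow> [] | _ # as \<Rightarrow> as) (f x))"
    by (intro comp_intros assms)
  have "drop n xs = rec_nat xs (\<lambda>_ r. case r of [] \<Rightarrow> [] | _ # as \<Rightarrow> as) n" for xs :: "'b list" and n
  proof (induction n)
    case (Suc n)
    have "drop (Suc n) xs = tl (drop n xs)" by (simp add: drop_Suc tl_drop)
    with Suc show ?case by (simp add: tl_def)
  qed simp
  then show "drop (f x) (l x) = rec_nat (l x) (\<lambda>_ r. case r of [] \<Rightarrow> [] | _ # as \<Rightarrow> as) (f x)" for x .
qed

lemma computable_take [comp_intros]: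
  "computable l \<Longrightarrow> computable f \<Longrightarrow> computable (\<lambda>x. take (f x) (l x))"
  unfolding take_rev[of _ "rev _", unfolded rev_rev_ident] length_rev by (intro comp_intros)

lemma computable_nth_default [comp_intros]:
  assumes "computable l" "computable f"
  shows "computable (\<lambda>x. nth_default d (l x) (f x))"
proof (rule computable_cong)
  show "computable (\<lambda>x. case drop (f x) (l x) of [] \<Rightarrow> d | a # _ \<Rightarrow> a)"
    by (intro comp_intros assms)
  show "nth_default d (l x) (f x) = (case drop (f x) (l x) of [] \<Rightarrow> d | a # _ \<Rightarrow> a)" for x
    by (cases "f x < length (l x)") (auto simp: nth_default_def Cons_nth_drop_Suc[symmetric])
qed

text \<open>On words over the natural numbers, \<^const>\<open>enc\<close> is the bijection \<^const>\<open>list_encode\<close>.\<close>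

lemma computable_list_encode [comp_intros]:
  assumes "computable f" shows "computable (\<lambda>x. list_encode (f x))"
  using computable_enc[OF assms] by (simp add: enc_nat_list)

lemma computable_list_decode [comp_intros]:
  assumes "computable f" shows "computable (\<lambda>x. list_decode (f x))"
proof -
  obtain \<phi> where "partrec \<phi>" "\<And>n::nat. \<phi> (enc n) = Some (enc n)"
    by (rule computableE[OF computable_id]) blast
  then have "computable list_decode" by (intro computableI[of \<phi>]) (auto simp: enc_nat_list)
  from computable_compose[OF this assms] show ?thesis .
qed

lemma computable_list_all [comp_intros]:
  assumes "computable (\<lambda>p. P (fst p) (snd p))" "computable l"
  shows "computable (\<lambda>x. \<forall>a\<in>set (l x). P x a)"
proof (rule computable_cong)
  show "computable (\<lambda>x. fold (\<lambda>a r. P x a \<and> r) (l x) True)"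
    by (intro comp_intros assms(2)
      computable_compose[OF assms(1), of "\<lambda>p. (fst p, fst (snd p))", simplified])
  have "fold (\<lambda>a r. P x a \<and> r) xs b = ((\<forall>a\<in>set xs. P x a) \<and> b)" for x xs b
    by (induction xs arbitrary: b) auto
  then show "(\<forall>a\<in>set (l x). P x a) = fold (\<lambda>a r. P x a \<and> r) (l x) True" for x by simp
qed

lemma computable_sum_list [comp_intros]:
  assumes "computable l" shows "computable (\<lambda>x. sum_list (l x) :: nat)"
proof (rule computable_cong)
  show "computable (\<lambda>x. foldr (\<lambda>a r. a + r) (l x) 0)" by (intro comp_intros assms)
qed (simp add: sum_list.eq_foldr)

subsection \<open>Finite tables\<close>

lemma computable_member_finite:
  assumes "finite A" "computable f" shows "computable (\<lambda>x. f x \<in> A)"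
  using assms(1) by (induction A) (simp_all add: comp_intros assms(2))

text \<open>A function on a finite set is a table. Such tables translate the codes of the letters.\<close>

lemma computable_on_finite:
  assumes "finite A"
  obtains h where "computable h" "\<And>a. a \<in> A \<Longrightarrow> h a = f a"
proof -
  have "\<exists>h. computable h \<and> (\<forall>a\<in>A. h a = f a)"
    using assms
  proof (induction A)
    case empty
    show ?case using computable_const by blast
  next
    case (insert a A)
    then obtain h where "computable h" "\<forall>a\<in>A. h a = f a" by blast
    then have "computable (\<lambda>x. if x = a then f a else h x)" by (intro comp_intros)
    with \<open>\<forall>a\<in>A. h a = f a\<close> show ?case by (intro exI[of _ "\<lambda>x. if x = a then f a else h x"]) auto
  qed
  with that show ?thesis by blast
qed

section \<open>Computably enumerable sets\<close>

text \<open>Running a program for a bounded time: every partial recursive function is the limit of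
  computable finite approximations, which are built along the construction of the function.\<close>

definition approximates :: "(nat \<times> nat \<Rightarrow> nat option) \<Rightarrow> (nat \<Rightarrow> nat option) \<Rightarrow> bool" where
  "approximates T f \<longleftrightarrow>
    (\<forall>n s v. T (n, s) = Some v \<longrightarrow> f n = Some v) \<and>
    (\<forall>n v. f n = Some v \<longrightarrow> (\<exists>s\<^sub>0. \<forall>s\<ge>s\<^sub>0. T (n, s) = Some v))"

lemma approximatesD:
  assumes "approximates T f"
  shows "T (n, s) = Some v \<Longrightarrow> f n = Some v"
    and "f n = Some v \<Longrightarrow> \<exists>s\<^sub>0. \<forall>s\<ge>s\<^sub>0. T (n, s) = Some v"
  using assms unfolding approximates_def by blast+

lemma approximates_const: "approximates (\<lambda>p. Some (f (fst p))) (\<lambda>n. Some (f n))"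
  unfolding approximates_def by auto

lemma approximates_comp:
  assumes f: "approximates T f" and g: "approximates U g"
  shows "approximates (\<lambda>p. Option.bind (U p) (\<lambda>m. T (m, snd p))) (\<lambda>n. Option.bind (g n) f)"
  unfolding approximates_def
proof (intro conjI allI impI)
  show "Option.bind (g n) f = Some v"
    if "Option.bind (U (n, s)) (\<lambda>m. T (m, snd (n, s))) = Some v" for n s v
    using that approximatesD(1)[OF f] approximatesD(1)[OF g] by (auto simp: bind_eq_Some_conv)
next
  fix n v assume "Option.bind (g n) f = Some v"
  then obtain m where "g n = Some m" "f m = Some v" by (auto simp: bind_eq_Some_conv)
  then obtain s t where "\<forall>r\<ge>s. U (n, r) = Some m" "\<forall>r\<ge>t. T (m, r) = Some v"
    using approximatesD(2)[OF f] approximatesD(2)[OF g] by blast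
  then show "\<exists>s\<^sub>0. \<forall>s\<ge>s\<^sub>0. Option.bind (U (n, s)) (\<lambda>m. T (m, snd (n, s))) = Some v"
    by (intro exI[of _ "max s t"]) auto
qed

lemma approximates_pair:
  assumes f: "approximates T f" and g: "approximates U g"
  shows "approximates (\<lambda>p. Option.bind (T p) (\<lambda>a. Option.bind (U p) (\<lambda>b. Some (prod_encode (a, b)))))
    (\<lambda>n. Option.bind (f n) (\<lambda>a. Option.bind (g n) (\<lambda>b. Some (prod_encode (a, b)))))"
  unfolding approximates_def
proof (intro conjI allI impI)
  show "Option.bind (f n) (\<lambda>a. Option.bind (g n) (\<lambda>b. Some (prod_encode (a, b)))) = Some v"
    if "Option.bind (T (n, s)) (\<lambda>a. Option.bind (U (n, s)) (\<lambda>b. Some (prod_encode (a, b)))) = Some v"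
    for n s v
    using that approximatesD(1)[OF f] approximatesD(1)[OF g] by (auto simp: bind_eq_Some_conv)
next
  fix n v assume "Option.bind (f n) (\<lambda>a. Option.bind (g n) (\<lambda>b. Some (prod_encode (a, b)))) = Some v"
  then obtain a b where "f n = Some a" "g n = Some b" and v: "v = prod_encode (a, b)"
    by (auto simp: bind_eq_Some_conv)
  then obtain s t where "\<forall>r\<ge>s. T (n, r) = Some a" "\<forall>r\<ge>t. U (n, r) = Some b"
    using approximatesD(2)[OF f] approximatesD(2)[OF g] by blast
  then show "\<exists>s\<^sub>0. \<forall>s\<ge>s\<^sub>0.
      Option.bind (T (n, s)) (\<lambda>a. Option.bind (U (n, s)) (\<lambda>b. Some (prod_encode (a, b)))) = Some v"
    by (intro exI[of _ "max s t"]) (auto simp: v)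
qed

text \<open>A terminating recursion uses finitely many values, so one stage serves all its steps.\<close>

lemma approximates_prec:
  assumes f: "approximates T f" and g: "approximates U g"
  shows "approximates
    (\<lambda>p. rec_nat (T (fst (prod_decode (fst p)), snd p))
      (\<lambda>i r. Option.bind r
        (\<lambda>v. U (prod_encode (fst (prod_decode (fst p)), prod_encode (i, v)), snd p)))
      (snd (prod_decode (fst p))))
    (\<lambda>n. case prod_decode n of (a, k) \<Rightarrow>
      rec_nat (f a) (\<lambda>i r. Option.bind r (\<lambda>v. g (prod_encode (a, prod_encode (i, v))))) k)"
proof -
  have 1: "rec_nat (T (a, s)) (\<lambda>i r. Option.bind r (\<lambda>v. U (prod_encode (a, prod_encode (i, v)), s))) k
      = Some w \<Longrightarrow>
    rec_nat (f a) (\<lambda>i r. Option.bind r (\<lambda>v. g (prod_encode (a, prod_encode (i, v))))) k = Some w"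
    for a k s w
    by (induction k arbitrary: w)
      (use approximatesD(1)[OF f] approximatesD(1)[OF g] in \<open>auto simp: bind_eq_Some_conv\<close>)
  have 2: "\<exists>s\<^sub>0. \<forall>s\<ge>s\<^sub>0. rec_nat (T (a, s))
      (\<lambda>i r. Option.bind r (\<lambda>v. U (prod_encode (a, prod_encode (i, v)), s))) k = Some w"
    if "rec_nat (f a) (\<lambda>i r. Option.bind r (\<lambda>v. g (prod_encode (a, prod_encode (i, v))))) k = Some w"
    for a k w
    using that
  proof (induction k arbitrary: w)
    case 0
    then show ?case using approximatesD(2)[OF f] by simp
  next
    case (Suc k)
    from Suc.prems obtain u where u:
      "rec_nat (f a) (\<lambda>i r. Option.bind r (\<lambda>v. g (prod_encode (a, prod_encode (i, v))))) k = Some u"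
      "g (prod_encode (a, prod_encode (k, u))) = Some w" by (auto simp: bind_eq_Some_conv)
    from Suc.IH[OF u(1)] approximatesD(2)[OF g u(2)] obtain s t where
      "\<forall>r\<ge>s. rec_nat (T (a, r))
        (\<lambda>i x. Option.bind x (\<lambda>v. U (prod_encode (a, prod_encode (i, v)), r))) k = Some u"
      "\<forall>r\<ge>t. U (prod_encode (a, prod_encode (k, u)), r) = Some w" by blast
    then show ?case by (intro exI[of _ "max s t"]) auto
  qed
  show ?thesis unfolding approximates_def using 1 2 by (auto simp: case_prod_beta)
qed

text \<open>At stage \<open>s\<close> the search for a zero inspects the arguments below \<open>s\<close>. It accepts an argument only
  if all smaller ones have converged at this stage, so a zero found too early to be the least one is
  never returned.\<close>

lemma approximates_mu:
  assumes f: "approximates T f"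
  defines "P \<equiv> \<lambda>p i. T (prod_encode (fst p, i), snd p) = Some 0 \<and>
    (\<forall>m<i. T (prod_encode (fst p, m), snd p) \<noteq> None)"
  shows "approximates
    (\<lambda>p. if \<exists>i<snd p. P p i then Some (LEAST i. snd p \<le> i \<or> P p i) else None)
    (\<lambda>a. minimise (\<lambda>n. f (prod_encode (a, n))))"
proof -
  have least: "(LEAST i. s \<le> i \<or> P (a, s) i) = (LEAST n. f (prod_encode (a, n)) = Some 0)"
    if i: "i < s" "P (a, s) i" for a s i
  proof -
    let ?n = "LEAST n. f (prod_encode (a, n)) = Some 0"
    have "f (prod_encode (a, i)) = Some 0"
      using i approximatesD(1)[OF f] unfolding P_def by auto
    then have n: "f (prod_encode (a, ?n)) = Some 0" "?n \<le> i" by (auto intro: LeastI Least_le)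
    have def: "T (prod_encode (a, m), s) \<noteq> None" if "m \<le> i" for m
      using i(2) that unfolding P_def by (cases "m = i") auto
    have "P (a, s) ?n"
      using def[OF n(2)] n approximatesD(1)[OF f] def unfolding P_def by fastforce
    moreover have "?n \<le> j" if "s \<le> j \<or> P (a, s) j" for j
      using that
    proof
      assume "P (a, s) j"
      then have "f (prod_encode (a, j)) = Some 0"
        using approximatesD(1)[OF f] unfolding P_def by auto
      then show ?thesis by (rule Least_le)
    qed (use i(1) n(2) in linarith)
    ultimately show ?thesis by (intro Least_equality) auto
  qed
  show ?thesis unfolding approximates_def
  proof (intro conjI allI impI)
    fix a s v
    assume "(if \<exists>i<snd (a, s). P (a, s) i then Some (LEAST i. snd (a, s) \<le> i \<or> P (a, s) i) else None)
      = Some v"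
    then obtain i where i: "i < s" "P (a, s) i" and v: "v = (LEAST n. f (prod_encode (a, n)) = Some 0)"
      using least by (auto split: if_splits)
    have "f (prod_encode (a, i)) = Some 0" "\<forall>m<i. f (prod_encode (a, m)) \<noteq> None"
      using i(2) approximatesD(1)[OF f] unfolding P_def by force+
    then show "minimise (\<lambda>n. f (prod_encode (a, n))) = Some v"
      unfolding minimise_def v by auto
  next
    fix a v assume *: "minimise (\<lambda>n. f (prod_encode (a, n))) = Some v"
    then obtain i where i: "f (prod_encode (a, i)) = Some 0" "\<forall>m<i. f (prod_encode (a, m)) \<noteq> None"
      and v: "v = (LEAST n. f (prod_encode (a, n)) = Some 0)"
      unfolding minimise_def by (auto split: if_splits)
    have "\<forall>m. \<exists>s\<^sub>0. m \<le> i \<longrightarrow>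
        (\<forall>s\<ge>s\<^sub>0. T (prod_encode (a, m), s) = f (prod_encode (a, m)))"
      using i approximatesD(2)[OF f] by (metis le_neq_implies_less not_Some_eq)
    then obtain \<sigma> where \<sigma>:
      "\<And>m s. m \<le> i \<Longrightarrow> \<sigma> m \<le> s \<Longrightarrow> T (prod_encode (a, m), s) = f (prod_encode (a, m))" by metis
    define s\<^sub>0 where "s\<^sub>0 = Suc i + (\<Sum>m\<le>i. \<sigma> m)"
    have bound: "\<sigma> m \<le> s" if "m \<le> i" "s\<^sub>0 \<le> s" for m s
    proof -
      have "\<sigma> m \<le> (\<Sum>m\<le>i. \<sigma> m)" using that(1) by (intro member_le_sum) auto
      with that(2) show ?thesis unfolding s\<^sub>0_def by linarith
    qed
    have "i < s \<and> P (a, s) i" if "s\<^sub>0 \<le> s" for s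
      using \<sigma> bound[OF _ that] that i unfolding P_def s\<^sub>0_def by auto
    then show "\<exists>s\<^sub>0. \<forall>s\<ge>s\<^sub>0. (if \<exists>i<snd (a, s). P (a, s) i
        then Some (LEAST i. snd (a, s) \<le> i \<or> P (a, s) i) else None) = Some v"
      using least v by (intro exI[of _ s\<^sub>0]) (metis fst_conv snd_conv)
  qed
qed

lemma computable_prod_encode [comp_intros]:
  assumes "computable f" "computable g" shows "computable (\<lambda>x. prod_encode (f x, g x))"
proof -
  have "computable (\<lambda>x. enc (f x, g x))" by (intro computable_enc comp_intros assms)
  then show ?thesis by simp
qed

lemma computable_prod_decode [comp_intros]:
  assumes "computable f" shows "computable (\<lambda>x. prod_decode (f x))"
proof -
  have "computable prod_decode"
    by (rule computableE[OF computable_id[where 'a = nat]]) (auto intro: computableI)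
  from computable_compose[OF this assms] show ?thesis .
qed

lemma partrec_approximable:
  assumes "partrec f"
  obtains T where "computable T" "approximates T f"
proof -
  have "\<exists>T. computable T \<and> approximates T f"
    using assms
  proof induction
    case zero
    show ?case by (rule exI, rule conjI[OF _ approximates_const]) (intro comp_intros)
  next
    case succ
    show ?case by (rule exI, rule conjI[OF _ approximates_const]) (intro comp_intros)
  next
    case left
    show ?case by (rule exI, rule conjI[OF _ approximates_const]) (intro comp_intros)
  next
    case right
    show ?case by (rule exI, rule conjI[OF _ approximates_const]) (intro comp_intros)
  next
    case (pair f g)
    then obtain T U where TU: "computable T" "computable U"
      and ap: "approximates T f" "approximates U g" by blast
    show ?case
      by (rule exI, rule conjI[OF _ approximates_pair[OF ap]]) (intro comp_intros computable_compose[OF TU(1)] computable_compose[OF TU(2)])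
  next
    case (comp f g)
    then obtain T U where TU: "computable T" "computable U"
      and ap: "approximates T f" "approximates U g" by blast
    show ?case
      by (rule exI, rule conjI[OF _ approximates_comp[OF ap]]) (intro comp_intros computable_compose[OF TU(1)] computable_compose[OF TU(2)])
  next
    case (prec f g)
    then obtain T U where TU: "computable T" "computable U"
      and ap: "approximates T f" "approximates U g" by blast
    show ?case
      by (rule exI, rule conjI[OF _ approximates_prec[OF ap]]) (intro comp_intros computable_compose[OF TU(1)] computable_compose[OF TU(2)])
  next
    case (mu f)
    then obtain T where T: "computable T" and ap: "approximates T f" by blast
    show ?case
      by (rule exI, rule conjI[OF _ approximates_mu[OF ap]])
        (intro comp_intros computable_Least computable_compose[OF T], blast)
  qed
  with that show ?thesis by blast
qed

text \<open>A program for the optional value becomes a partial function by diverging on \<^const>\<open>None\<close>: it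
  searches for a zero of a function that is constant in the searched variable.\<close>

lemma partrec_of_computable_option:
  fixes f :: "nat \<Rightarrow> nat option"
  assumes "computable f" shows "partrec f"
proof -
  have c: "computable (\<lambda>n. case f n of None \<Rightarrow> 0 | Some v \<Rightarrow> v)"
    "computable (\<lambda>p :: nat \<times> nat. if f (fst p) = None then 1 else 0 :: nat)"
    by (intro comp_intros assms computable_compose[OF assms])+
  obtain \<phi> where "partrec \<phi>"
    and \<phi>: "\<And>p :: nat \<times> nat. \<phi> (enc p) = Some (enc (if f (fst p) = None then 1 else 0 :: nat))"
    using c(2) by (rule computableE) blast
  from partrec.pair[OF partrec.mu[OF this(1)] computable_imp_partrec[OF c(1)]]
  have "partrec (\<lambda>n. Option.bind (minimise (\<lambda>s. \<phi> (prod_encode (n, s)))) (\<lambda>a.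
    Option.bind (Some (case f n of None \<Rightarrow> 0 | Some v \<Rightarrow> v)) (\<lambda>b. Some (prod_encode (a, b)))))" .
  from partrec.comp[OF partrec.right this]
  have "partrec (\<lambda>n. Option.bind (Option.bind (minimise (\<lambda>s. \<phi> (prod_encode (n, s)))) (\<lambda>a.
    Option.bind (Some (case f n of None \<Rightarrow> 0 | Some v \<Rightarrow> v)) (\<lambda>b. Some (prod_encode (a, b)))))
     (\<lambda>n. Some (snd (prod_decode n))))" .
  also have "(\<lambda>n. Option.bind (Option.bind (minimise (\<lambda>s. \<phi> (prod_encode (n, s)))) (\<lambda>a.
    Option.bind (Some (case f n of None \<Rightarrow> 0 | Some v \<Rightarrow> v)) (\<lambda>b. Some (prod_encode (a, b)))))
     (\<lambda>n. Some (snd (prod_decode n)))) = f"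
  proof
    fix n
    have "\<phi> (prod_encode (n, s)) = Some (if f n = None then 1 else 0)" for s
      using \<phi>[of "(n, s)"] by simp
    then show "Option.bind (Option.bind (minimise (\<lambda>s. \<phi> (prod_encode (n, s)))) (\<lambda>a.
      Option.bind (Some (case f n of None \<Rightarrow> 0 | Some v \<Rightarrow> v)) (\<lambda>b. Some (prod_encode (a, b)))))
       (\<lambda>n. Some (snd (prod_decode n))) = f n"
      by (cases "f n") (simp_all add: minimise_def)
  qed
  finally show ?thesis .
qed

text \<open>Domains of partial functions become projections of computable relations, with the stage of the
  approximation as the witness.\<close>

lemma comp_enumerable_iff:
  "comp_enumerable M \<longleftrightarrow> (\<exists>R. computable R \<and> M = {n. \<exists>s. R (n, s :: nat)})"
proof
  assume "comp_enumerable M"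
  then obtain f where "partrec f" and M: "M = {n. f n \<noteq> None}" unfolding comp_enumerable_def by blast
  from this(1) obtain T where "computable T" and T: "approximates T f" by (rule partrec_approximable)
  have "computable (\<lambda>p. T p \<noteq> None)" by (intro comp_intros \<open>computable T\<close>)
  moreover have "M = {n. \<exists>s. T (n, s) \<noteq> None}"
  proof -
    have "f n \<noteq> None \<longleftrightarrow> (\<exists>s. T (n, s) \<noteq> None)" for n
      using approximatesD[OF T] by (metis not_Some_eq order_refl)
    then show ?thesis unfolding M by blast
  qed
  ultimately show "\<exists>R. computable R \<and> M = {n. \<exists>s. R (n, s :: nat)}"
    by (intro exI[of _ "\<lambda>p. T p \<noteq> None"]) auto
next
  assume "\<exists>R. computable R \<and> M = {n. \<exists>s. R (n, s :: nat)}"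
  then obtain R :: "nat \<times> nat \<Rightarrow> bool" where R: "computable R" and M: "M = {n. \<exists>s. R (n, s :: nat)}" by blast
  have "computable (\<lambda>p. if R p then 0 else 1 :: nat)" by (intro comp_intros R)
  then obtain \<phi> where "partrec \<phi>" and \<phi>: "\<And>p. \<phi> (enc p) = Some (enc (if R p then 0 else 1 :: nat))"
    by (rule computableE) blast
  have *: "\<phi> (prod_encode (n, s)) = Some (if R (n, s) then 0 else 1)" for n s
    using \<phi>[of "(n, s)"] by simp
  have "M = {n. minimise (\<lambda>s. \<phi> (prod_encode (n, s))) \<noteq> None}"
    unfolding M minimise_def * by auto
  with partrec.mu[OF \<open>partrec \<phi>\<close>] show "comp_enumerable M"
    unfolding comp_enumerable_def by blast
qed

text \<open>The witness is a word and a number: the word collects the data that are searched for, and the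
  number is a stage in the enumeration of a given set.\<close>

lemma comp_enumerableI:
  assumes "computable R"
  shows "comp_enumerable {n. \<exists>w s. R (n, w :: nat list, s :: nat)}"
proof -
  define R' where "R' p = R (fst p, list_decode (fst (prod_decode (snd p))), snd (prod_decode (snd p)))"
    for p :: "nat \<times> nat"
  have "computable R'"
    unfolding R'_def by (intro computable_compose[OF assms] comp_intros)
  moreover have "{n. \<exists>w s. R (n, w, s)} = {n. \<exists>s. R' (n, s)}"
  proof (intro equalityI subsetI)
    fix n assume "n \<in> {n. \<exists>w s. R (n, w, s)}"
    then obtain w s where "R (n, w, s)" by blast
    then have "R' (n, prod_encode (list_encode w, s))" by (simp add: R'_def)
    then show "n \<in> {n. \<exists>s. R' (n, s)}" by blast
  qed (auto simp: R'_def)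
  ultimately show ?thesis
    unfolding comp_enumerable_iff by blast
qed

lemma comp_enumerable_words_iff:
  "comp_enumerable (list_encode ` L) \<longleftrightarrow>
    (\<exists>R. computable R \<and> (\<forall>w. w \<in> L \<longleftrightarrow> (\<exists>s. R (w, s :: nat))))"
proof
  assume "comp_enumerable (list_encode ` L)"
  then obtain R where R: "computable R" "list_encode ` L = {n. \<exists>s. R (n, s :: nat)}"
    unfolding comp_enumerable_iff by blast
  have "w \<in> L \<longleftrightarrow> (\<exists>s. R (list_encode w, s))" for w
  proof -
    have "w \<in> L \<longleftrightarrow> list_encode w \<in> list_encode ` L" by (simp add: inj_image_mem_iff inj_list_encode)
    then show ?thesis unfolding R(2) by simp
  qed
  moreover have "computable (\<lambda>p. R (list_encode (fst p), snd p))"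
    by (intro computable_compose[OF R(1)] comp_intros)
  ultimately show "\<exists>R. computable R \<and> (\<forall>w. w \<in> L \<longleftrightarrow> (\<exists>s. R (w, s :: nat)))"
    by (intro exI[of _ "\<lambda>p. R (list_encode (fst p), snd p)"]) simp
next
  assume "\<exists>R. computable R \<and> (\<forall>w. w \<in> L \<longleftrightarrow> (\<exists>s. R (w, s :: nat)))"
  then obtain R where R: "computable R" "\<And>w. w \<in> L \<longleftrightarrow> (\<exists>s. R (w, s :: nat))" by blast
  have "computable (\<lambda>p. R (list_decode (fst p), snd p))"
    by (intro computable_compose[OF R(1)] comp_intros)
  moreover have "list_encode ` L = {n. \<exists>s. R (list_decode n, s)}"
    unfolding R(2)[symmetric] by (auto simp: image_iff intro: list_decode_inverse[symmetric])
  ultimately show "comp_enumerable (list_encode ` L)"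
    unfolding comp_enumerable_iff by (intro exI[of _ "\<lambda>p. R (list_decode (fst p), snd p)"]) simp
qed

section \<open>Computable functionals and Medvedev reducibility\<close>

text \<open>A total functional with a computable modulus of continuity: the value at \<open>n\<close> is computed from the
  first \<open>\<beta> n\<close> entries of the argument. Because of the modulus, preimages of effectively
  closed sets are effectively closed.\<close>

definition cfunctional ::
  "nat set \<Rightarrow> nat set \<Rightarrow> ((nat \<Rightarrow> nat) \<Rightarrow> (nat \<Rightarrow> nat)) \<Rightarrow> bool" where
  "cfunctional A B F \<longleftrightarrow> (\<exists>\<phi> \<beta>. computable \<phi> \<and> computable \<beta> \<and>
    (\<forall>x\<in>seqs A. F x \<in> seqs B \<and> (\<forall>n. F x n = \<phi> (n, map x [0..<\<beta> n]))))"

lemma cfunctionalI: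
  assumes "computable \<phi>" "computable \<beta>" "\<And>x. x \<in> seqs A \<Longrightarrow> F x \<in> seqs B"
    "\<And>x n. x \<in> seqs A \<Longrightarrow> F x n = \<phi> (n, map x [0..<\<beta> n])"
  shows "cfunctional A B F"
  unfolding cfunctional_def using assms by blast

lemma cfunctional_seqs: "cfunctional A B F \<Longrightarrow> x \<in> seqs A \<Longrightarrow> F x \<in> seqs B"
  unfolding cfunctional_def by blast

lemma seqs_apply: "x \<in> seqs A \<Longrightarrow> x i \<in> A"
  by (auto simp: seqs_def)

lemma map_in_lists: "x \<in> seqs A \<Longrightarrow> map x is \<in> lists A"
  by (auto simp: seqs_apply)

lemma map_upt_prefix:
  assumes "k \<le> l" shows "take k (map x [0..<l]) = map x [0..<k]"
  using assms by (simp add: take_map)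

lemma prefix_of_seq_iff: "prefix_of_seq w x \<longleftrightarrow> (\<forall>i<length w. x i = w ! i)"
  unfolding prefix_of_seq_def list_eq_iff_nth_eq by auto

text \<open>This turns what is computed from a word into a value of the functional at a sequence, so that it
  consists of letters of the target alphabet.\<close>

lemma word_extends:
  assumes "u \<in> lists A" "u \<noteq> []"
  obtains x where "x \<in> seqs A" "map x [0..<length u] = u"
proof
  let ?x = "\<lambda>i. if i < length u then u ! i else u ! 0"
  show "?x \<in> seqs A" using assms by (auto simp: seqs_def)
  show "map ?x [0..<length u] = u" by (rule nth_equalityI) auto
qed

lemma cfunctional_computable_on:
  assumes F: "cfunctional A B F" and A: "finite A" and D: "D \<subseteq> seqs A"
  shows "computable_on A B D F"
proof -
  obtain \<phi> \<beta> where \<phi>: "computable \<phi>" and \<beta>: "computable \<beta>"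
    and FB: "\<And>x. x \<in> seqs A \<Longrightarrow> F x \<in> seqs B"
    and Fx: "\<And>x n. x \<in> seqs A \<Longrightarrow> F x n = \<phi> (n, map x [0..<\<beta> n])"
    using F unfolding cfunctional_def by blast
  \<comment> \<open>The number of values of the functional that a word of length \<open>k\<close> determines, cut off at \<open>k\<close>.\<close>
  define l where "l k = (LEAST n. k \<le> n \<or> \<not> \<beta> n \<le> k)" for k
  have l: "l k \<le> k" for k unfolding l_def by (rule Least_le) simp
  have \<beta>_le: "\<beta> n \<le> k" if "n < l k" for n k
    using not_less_Least[OF that[unfolded l_def]] by blast
  have l_ge: "m \<le> l k" if "m \<le> k" "\<And>n. n < m \<Longrightarrow> \<beta> n \<le> k" for m k
  proof (rule ccontr)
    assume "\<not> m \<le> l k"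
    moreover have "k \<le> l k \<or> \<not> \<beta> (l k) \<le> k" unfolding l_def by (rule LeastI[of _ k]) simp
    ultimately show False using that by auto
  qed
  have l_mono: "l j \<le> l k" if "j \<le> k" for j k
    using l[of j] \<beta>_le[of _ j] that by (intro l_ge) (auto intro: order_trans)
  define g where "g u = map (\<lambda>n. \<phi> (n, take (\<beta> n) u)) [0..<l (length u)]" for u
  define f where "f u = (if u \<in> lists A then Some (g u) else None)" for u
  have g_map: "g (map x [0..<k]) = map (F x) [0..<l k]" if "x \<in> seqs A" for x k
    using Fx[OF that] \<beta>_le by (auto simp: g_def map_upt_prefix)
  have "partrec_words f"
  proof -
    have l_comp: "computable l" unfolding l_def
      by (rule computable_Least) (intro comp_intros computable_compose[OF \<beta>], blast)
    have "computable (\<lambda>n. if \<forall>a\<in>set (list_decode n). a \<in> A then Some (list_encode (g (list_decode n))) else None)"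
      unfolding g_def
      by (intro comp_intros computable_member_finite[OF A] computable_compose[OF \<beta>]
          computable_compose[OF \<phi>] computable_compose[OF l_comp])
    moreover have "map_option list_encode (f (list_decode n)) =
      (if \<forall>a\<in>set (list_decode n). a \<in> A then Some (list_encode (g (list_decode n))) else None)" for n
      by (auto simp: f_def)
    ultimately show ?thesis
      unfolding partrec_words_def by (intro partrec_of_computable_option) simp
  qed
  moreover have "ran f \<subseteq> lists B"
  proof -
    have "g u \<in> lists B" if u: "u \<in> lists A" for u
    proof (cases "u = []")
      case True
      then show ?thesis using l[of 0] by (simp add: g_def)
    next
      case False
      from word_extends[OF u this] obtain x where x: "x \<in> seqs A" "map x [0..<length u] = u" .
      have "g u = map (F x) [0..<l (length u)]" using g_map[OF x(1), of "length u"] x(2) by simp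
      then show ?thesis using FB[OF x(1)] map_in_lists by auto
    qed
    then show ?thesis by (auto simp: ran_def f_def split: if_splits)
  qed
  moreover have "prefix (g u) (g v)" if "prefix u v" for u v
  proof -
    from that obtain w where v: "v = u @ w" by (auto simp: prefix_def)
    have lu: "l (length u) \<le> l (length v)" using v by (intro l_mono) simp
    have "g u = take (l (length u)) (g v)"
      using lu \<beta>_le[of _ "length u"] by (auto simp: g_def take_map v)
    then show ?thesis by (metis take_is_prefix)
  qed
  moreover have "filterlim (\<lambda>k. length (the (f (map x [0..<Suc k])))) at_top sequentially"
    if "x \<in> D" for x
    unfolding filterlim_at_top eventually_sequentially
  proof
    fix Z
    define N where "N = Z + (\<Sum>n<Z. \<beta> n)"
    have \<beta>N: "\<beta> n \<le> N" if "n < Z" for n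
      using member_le_sum[of n "{..<Z}" \<beta>] that unfolding N_def by simp
    have "Z \<le> length (the (f (map x [0..<Suc k])))" if "N \<le> k" for k
    proof -
      have "x \<in> seqs A" using \<open>x \<in> D\<close> D by blast
      then have "map x [0..<Suc k] \<in> lists A" by (rule map_in_lists)
      moreover have "Z \<le> l (Suc k)"
      proof (rule l_ge)
        show "Z \<le> Suc k" using that by (simp add: N_def)
        show "\<beta> n \<le> Suc k" if "n < Z" for n using \<beta>N[OF that] \<open>N \<le> k\<close> by linarith
      qed
      ultimately show ?thesis using g_map[OF \<open>x \<in> seqs A\<close>, of "Suc k"] by (simp add: f_def del: upt_Suc)
    qed
    then show "\<exists>N. \<forall>k\<ge>N. Z \<le> length (the (f (map x [0..<Suc k])))" by blast
  qed
  moreover have "map x [0..<Suc k] \<in> dom f \<and> prefix_of_seq (the (f (map x [0..<Suc k]))) (F x)"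
    if "x \<in> D" for x k
  proof -
    have x: "x \<in> seqs A" using that D by blast
    then have "map x [0..<Suc k] \<in> lists A" by (rule map_in_lists)
    then show ?thesis using g_map[OF x, of "Suc k"]
      by (simp add: f_def dom_def prefix_of_seq_def del: upt_Suc)
  qed
  moreover have "dom f \<subseteq> lists A" by (auto simp: f_def dom_def)
  ultimately show ?thesis
    unfolding computable_on_def using D FB
    by (intro conjI exI[of _ f]) (auto simp: f_def split: if_splits)
qed

lemma medvedev_leI:
  assumes "cfunctional A B F" "finite A" "finite B" "X \<subseteq> seqs A" "Y \<subseteq> seqs B"
    "\<And>x. x \<in> X \<Longrightarrow> F x \<in> Y"
  shows "medvedev_le Y X"
  unfolding medvedev_le_def using assms(2-6) cfunctional_computable_on[OF assms(1,2,4)]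
  by (intro exI[of _ A] exI[of _ B] exI[of _ X] exI[of _ F] conjI) auto

text \<open>A realiser of a functional need not be defined at the empty word. Composition requires that it is,
  as the realiser that comes first may start with empty output.\<close>

lemma partrec_words_at_Nil:
  assumes "partrec_words f" shows "partrec_words (f([] := Some []))"
proof -
  define p where "p n = map_option list_encode (f (list_decode n))" for n
  have p: "partrec p" using assms unfolding partrec_words_def p_def .
  have c: "computable (\<lambda>n. prod_encode (n, if n = 0 then 0 else 1))" by (intro comp_intros)
  have "partrec (\<lambda>n. Option.bind (Some (prod_encode (n, if n = 0 then 0 else 1)))
    (\<lambda>m. case prod_decode m of (a, k) \<Rightarrow> rec_nat (Some 0) (\<lambda>i r. Option.bind r (\<lambda>v.
      Option.bind (Some (fst (prod_decode (prod_encode (a, prod_encode (i, v)))))) p)) k))"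
    by (intro partrec.comp partrec.prec partrec.zero partrec.left p computable_imp_partrec c)
  also have "\<dots> = (\<lambda>n. if n = 0 then Some 0 else p n)" by (rule ext) simp
  also have "\<dots> = (\<lambda>n. map_option list_encode ((f([] := Some [])) (list_decode n)))"
  proof
    fix n
    have "n = 0 \<longleftrightarrow> list_decode n = []" by (metis list_decode.simps(1) list_decode_eq)
    then show "(if n = 0 then Some 0 else p n) = map_option list_encode ((f([] := Some [])) (list_decode n))"
      by (auto simp: p_def)
  qed
  finally show ?thesis unfolding partrec_words_def .
qed

lemma partrec_words_comp:
  assumes "partrec_words f" "partrec_words g"
  shows "partrec_words (\<lambda>u. Option.bind (g u) f)"
proof -
  have "map_option list_encode (Option.bind (g (list_decode n)) f) =
      Option.bind (map_option list_encode (g (list_decode n))) (\<lambda>n. map_option list_encode (f (list_decode n)))"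
    for n by (cases "g (list_decode n)") auto
  then show ?thesis using partrec.comp[OF assms[unfolded partrec_words_def]]
    unfolding partrec_words_def by simp
qed

lemma computable_onE:
  assumes "computable_on A B D F"
  obtains f where "partrec_words f" "dom f \<subseteq> lists A" "ran f \<subseteq> lists B"
    "\<And>u v. u \<in> dom f \<Longrightarrow> v \<in> dom f \<Longrightarrow> prefix u v \<Longrightarrow> prefix (the (f u)) (the (f v))"
    "\<And>x k. x \<in> D \<Longrightarrow> map x [0..<Suc k] \<in> dom f"
    "\<And>x k. x \<in> D \<Longrightarrow> prefix_of_seq (the (f (map x [0..<Suc k]))) (F x)"
    "\<And>x. x \<in> D \<Longrightarrow> filterlim (\<lambda>k. length (the (f (map x [0..<Suc k])))) at_top sequentially"
proof -
  from assms obtain f where f: "partrec_words f" "dom f \<subseteq> lists A" "ran f \<subseteq> lists B"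
    and mono: "\<forall>u\<in>dom f. \<forall>v\<in>dom f. prefix u v \<longrightarrow> prefix (the (f u)) (the (f v))"
    and x: "\<forall>x\<in>D. (\<forall>k. map x [0..<Suc k] \<in> dom f \<and>
             prefix_of_seq (the (f (map x [0..<Suc k]))) (F x)) \<and>
        filterlim (\<lambda>k. length (the (f (map x [0..<Suc k])))) at_top sequentially"
    unfolding computable_on_def by (elim exE conjE)
  show ?thesis
  proof (rule that[OF f])
    show "prefix (the (f u)) (the (f v))" if "u \<in> dom f" "v \<in> dom f" "prefix u v" for u v
      using mono that by blast
    show "map x [0..<Suc k] \<in> dom f" "prefix_of_seq (the (f (map x [0..<Suc k]))) (F x)"
      "filterlim (\<lambda>k. length (the (f (map x [0..<Suc k])))) at_top sequentially" if "x \<in> D" for x k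
      using bspec[OF x that] by blast+
  qed
qed

lemma computable_onI:
  assumes "D \<subseteq> seqs A" "F ` D \<subseteq> seqs B" "partrec_words f" "dom f \<subseteq> lists A" "ran f \<subseteq> lists B"
    and mono: "\<And>u v. u \<in> dom f \<Longrightarrow> v \<in> dom f \<Longrightarrow> prefix u v \<Longrightarrow> prefix (the (f u)) (the (f v))"
    and x: "\<And>x k. x \<in> D \<Longrightarrow> map x [0..<Suc k] \<in> dom f"
      "\<And>x k. x \<in> D \<Longrightarrow> prefix_of_seq (the (f (map x [0..<Suc k]))) (F x)"
      "\<And>x. x \<in> D \<Longrightarrow> filterlim (\<lambda>k. length (the (f (map x [0..<Suc k])))) at_top sequentially"
  shows "computable_on A B D F"
  unfolding computable_on_def
proof (intro conjI exI[of _ f] ballI allI impI)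
  show "prefix (the (f u)) (the (f v))" if "u \<in> dom f" "v \<in> dom f" "prefix u v" for u v
    by (rule mono[OF that])
  show "map x [0..<Suc k] \<in> dom f" if "x \<in> D" for x k by (rule x(1)[OF that])
  show "prefix_of_seq (the (f (map x [0..<Suc k]))) (F x)" if "x \<in> D" for x k by (rule x(2)[OF that])
  show "filterlim (\<lambda>k. length (the (f (map x [0..<Suc k])))) at_top sequentially" if "x \<in> D" for x
    by (rule x(3)[OF that])
qed (fact assms(1-5))+

lemma computable_on_comp:
  assumes F: "computable_on A B D F" and F': "computable_on B' C D' F'"
    and X: "X \<subseteq> D" "F ` X \<subseteq> D'"
  shows "computable_on A C X (F' \<circ> F)"
proof -
  obtain f where f: "partrec_words f" "dom f \<subseteq> lists A" "ran f \<subseteq> lists B"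
    "\<And>u v. u \<in> dom f \<Longrightarrow> v \<in> dom f \<Longrightarrow> prefix u v \<Longrightarrow> prefix (the (f u)) (the (f v))"
    "\<And>x k. x \<in> D \<Longrightarrow> map x [0..<Suc k] \<in> dom f"
    "\<And>x k. x \<in> D \<Longrightarrow> prefix_of_seq (the (f (map x [0..<Suc k]))) (F x)"
    "\<And>x. x \<in> D \<Longrightarrow> filterlim (\<lambda>k. length (the (f (map x [0..<Suc k])))) at_top sequentially"
    using F by (rule computable_onE) blast
  obtain f' where f': "partrec_words f'" "dom f' \<subseteq> lists B'" "ran f' \<subseteq> lists C"
    "\<And>u v. u \<in> dom f' \<Longrightarrow> v \<in> dom f' \<Longrightarrow> prefix u v \<Longrightarrow> prefix (the (f' u)) (the (f' v))"
    "\<And>x k. x \<in> D' \<Longrightarrow> map x [0..<Suc k] \<in> dom f'"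
    "\<And>x k. x \<in> D' \<Longrightarrow> prefix_of_seq (the (f' (map x [0..<Suc k]))) (F' x)"
    "\<And>x. x \<in> D' \<Longrightarrow> filterlim (\<lambda>k. length (the (f' (map x [0..<Suc k])))) at_top sequentially"
    using F' by (rule computable_onE) blast
  \<comment> \<open>The first functional may output the empty word for a while, where the second one need not
    be defined.\<close>
  define f'' where "f'' = f'([] := Some [])"
  define h where "h u = Option.bind (f u) f''" for u
  have f''_mono: "prefix (the (f'' u)) (the (f'' v))"
    if "u \<in> dom f''" "v \<in> dom f''" "prefix u v" for u v
    using that f'(4)[of u v] unfolding f''_def by (auto split: if_splits)
  have val: "the (f (map x [0..<Suc k])) = map (F x) [0..<length (the (f (map x [0..<Suc k])))]"
    "map x [0..<Suc k] \<in> dom f" if "x \<in> X" for x k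
    using f(5,6)[of x k] that X unfolding prefix_of_seq_def by auto
  have f''_x: "map (F x) [0..<k] \<in> dom f'' \<and> prefix_of_seq (the (f'' (map (F x) [0..<k]))) (F' (F x))"
    if "x \<in> X" for x k
    using f'(5,6)[of "F x" "k - 1"] that X unfolding f''_def by (cases k) (auto simp: prefix_of_seq_def simp del: upt_Suc)
  have h_x: "h (map x [0..<Suc k]) = f'' (map (F x) [0..<length (the (f (map x [0..<Suc k])))])"
    if "x \<in> X" for x k
    using val[OF that, of k] unfolding h_def by (auto simp del: upt_Suc)
  have h_lim: "filterlim (\<lambda>k. length (the (h (map x [0..<Suc k])))) at_top sequentially" if x: "x \<in> X" for x
  proof -
    have "filterlim (\<lambda>k. length (the (f'' (map (F x) [0..<k])))) at_top sequentially"
      using f'(7)[of "F x"] x X unfolding f''_def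
      by (subst filterlim_sequentially_Suc[symmetric]) (auto simp del: upt_Suc)
    from filterlim_compose[OF this f(7)[of x]] show ?thesis
      using x X unfolding h_x[OF x] by auto
  qed
  have h_dom: "map x [0..<Suc k] \<in> dom h \<and> prefix_of_seq (the (h (map x [0..<Suc k]))) ((F' \<circ> F) x)"
    if x: "x \<in> X" for x k
    using f''_x[OF x] h_x[OF x, of k] unfolding dom_def by auto
  have h_mono: "prefix (the (h u)) (the (h v))" if *: "u \<in> dom h" "v \<in> dom h" and "prefix u v" for u v
  proof -
    obtain u' v' where uv: "f u = Some u'" "f v = Some v'" "u' \<in> dom f''" "v' \<in> dom f''"
      using * unfolding h_def dom_def by (auto simp: bind_eq_Some_conv)
    then have "prefix u' v'" using f(4)[of u v] \<open>prefix u v\<close> by auto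
    with uv f''_mono[of u' v'] show ?thesis by (simp add: h_def)
  qed
  have h_partrec: "partrec_words h"
    unfolding h_def f''_def by (intro partrec_words_comp partrec_words_at_Nil f(1) f'(1))
  have h_domain: "dom h \<subseteq> lists A" using f(2) unfolding h_def by (auto simp: bind_eq_Some_conv dom_def)
  have h_range: "ran h \<subseteq> lists C"
    using f'(3) unfolding h_def f''_def by (auto simp: bind_eq_Some_conv ran_def split: if_splits)
  have spaces: "X \<subseteq> seqs A" "(F' \<circ> F) ` X \<subseteq> seqs C"
  proof -
    have "D \<subseteq> seqs A" "F' ` D' \<subseteq> seqs C"
      using F F' unfolding computable_on_def by simp_all
    with X show "X \<subseteq> seqs A" "(F' \<circ> F) ` X \<subseteq> seqs C"
      unfolding image_comp[symmetric] by blast+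
  qed
  show ?thesis
    by (rule computable_onI[OF spaces h_partrec h_domain h_range h_mono
          h_dom[THEN conjunct1] h_dom[THEN conjunct2] h_lim])
qed

lemma medvedev_le_trans:
  assumes "medvedev_le Z Y" "medvedev_le Y X" shows "medvedev_le Z X"
proof -
  from assms(1) obtain B' C D' F' where
    1: "finite C" "Z \<subseteq> seqs C" "Y \<subseteq> D'" "computable_on B' C D' F'" "F' ` Y \<subseteq> Z"
    unfolding medvedev_le_def by (elim exE conjE)
  from assms(2) obtain A B D F where
    2: "finite A" "X \<subseteq> seqs A" "X \<subseteq> D" "computable_on A B D F" "F ` X \<subseteq> Y"
    unfolding medvedev_le_def by (elim exE conjE)
  have "computable_on A C X (F' \<circ> F)" using 1 2 by (intro computable_on_comp[OF 2(4) 1(4)]) auto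
  moreover have "(F' \<circ> F) ` X \<subseteq> Z" using 1(5) 2(5) by auto
  ultimately show ?thesis unfolding medvedev_le_def using 1(1,2) 2(1,2)
    by (intro exI[of _ A] exI[of _ C] exI[of _ X] exI[of _ "F' \<circ> F"] conjI) auto
qed

lemma medvedev_degree_eqI:
  assumes "medvedev_le X Y" "medvedev_le Y X" shows "medvedev_degree X = medvedev_degree Y"
proof -
  have eq: "medvedev_equiv X Z \<longleftrightarrow> medvedev_equiv Y Z" for Z
    unfolding medvedev_equiv_def
    using medvedev_le_trans[OF assms(1), of Z] medvedev_le_trans[OF assms(2), of Z]
      medvedev_le_trans[OF _ assms(1), of Z] medvedev_le_trans[OF _ assms(2), of Z] by argo
  show ?thesis unfolding medvedev_degree_def by (rule Collect_cong) (rule eq)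
qed

text \<open>A forbidden prefix of the output is produced by a finite part of the input. So the words that are
  long enough to determine an output with a forbidden prefix can be enumerated.\<close>

lemma effectively_closed_vimage:
  assumes F: "cfunctional A B F" and A: "finite A" and Q: "effectively_closed B Q"
  shows "effectively_closed A {x \<in> seqs A. F x \<in> Q}"
proof -
  obtain \<phi> \<beta> where \<phi>: "computable \<phi>" and \<beta>: "computable \<beta>"
    and FB: "\<And>x. x \<in> seqs A \<Longrightarrow> F x \<in> seqs B"
    and Fx: "\<And>x n. x \<in> seqs A \<Longrightarrow> F x n = \<phi> (n, map x [0..<\<beta> n])"
    using F unfolding cfunctional_def by blast
  obtain L where L: "L \<subseteq> lists B" "comp_enumerable (list_encode ` L)"
    "seqs B - Q = (\<Union>w\<in>L. cylinder B w)"
    using Q unfolding effectively_closed_def by blast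
  obtain R where R: "computable R" and R_iff: "\<And>w. w \<in> L \<longleftrightarrow> (\<exists>s. R (w, s :: nat))"
    using L(2) unfolding comp_enumerable_words_iff by blast
  define out where "out u w \<longleftrightarrow> (\<forall>n<length w. \<beta> n \<le> length u \<and>
    \<phi> (n, take (\<beta> n) u) = nth_default 0 w n)" for u w
  define L' where "L' = {u \<in> lists A. \<exists>w\<in>L. out u w}"
  have "comp_enumerable (list_encode ` L')"
  proof -
    define R' where "R' p \<longleftrightarrow> (\<forall>a\<in>set (list_decode (fst p)). a \<in> A) \<and>
      out (list_decode (fst p)) (fst (snd p)) \<and> R (snd p)" for p :: "nat \<times> nat list \<times> nat"
    have "computable R'" unfolding R'_def out_def
      by (intro comp_intros computable_member_finite[OF A] computable_compose[OF \<beta>]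
          computable_compose[OF \<phi>] computable_compose[OF R])
    moreover have "list_encode ` L' = {n. \<exists>w s. R' (n, w, s)}"
    proof (intro equalityI subsetI)
      fix n assume "n \<in> list_encode ` L'"
      then obtain u w where "n = list_encode u" "u \<in> lists A" "w \<in> L" "out u w"
        unfolding L'_def by blast
      then show "n \<in> {n. \<exists>w s. R' (n, w, s)}" by (auto simp: R'_def R_iff)
    next
      fix n assume "n \<in> {n. \<exists>w s. R' (n, w, s)}"
      then have "list_decode n \<in> L'" unfolding L'_def R'_def using R_iff by auto
      then show "n \<in> list_encode ` L'" by (metis imageI list_decode_inverse)
    qed
    ultimately show ?thesis using comp_enumerableI by simp
  qed
  moreover have "seqs A - {x \<in> seqs A. F x \<in> Q} = (\<Union>u\<in>L'. cylinder A u)"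
  proof (intro equalityI subsetI)
    fix x assume x: "x \<in> seqs A - {x \<in> seqs A. F x \<in> Q}"
    then have "F x \<in> seqs B - Q" using FB by auto
    then obtain w where w: "w \<in> L" "prefix_of_seq w (F x)" using L(3) by (auto simp: cylinder_def)
    let ?k = "\<Sum>n<length w. \<beta> n"
    have \<beta>k: "\<beta> n \<le> ?k" if "n < length w" for n using that by (intro member_le_sum) auto
    have "out (map x [0..<?k]) w" unfolding out_def
      using \<beta>k w(2) x by (auto simp: map_upt_prefix nth_default_nth Fx[symmetric] prefix_of_seq_iff)
    then have "map x [0..<?k] \<in> L'" using w(1) x map_in_lists unfolding L'_def by blast
    moreover have "x \<in> cylinder A (map x [0..<?k])" using x by (simp add: cylinder_def prefix_of_seq_def)
    ultimately show "x \<in> (\<Union>u\<in>L'. cylinder A u)" by blast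
  next
    fix x assume "x \<in> (\<Union>u\<in>L'. cylinder A u)"
    then obtain u w where u: "x \<in> seqs A" "prefix_of_seq u x" "w \<in> L" "out u w"
      unfolding L'_def cylinder_def by blast
    have "prefix_of_seq w (F x)" unfolding prefix_of_seq_iff
    proof (intro allI impI)
      fix n assume n: "n < length w"
      have "u = map x [0..<length u]" using u(2) by (simp add: prefix_of_seq_def)
      moreover have "\<beta> n \<le> length u" "\<phi> (n, take (\<beta> n) u) = w ! n"
        using u(4) n unfolding out_def by (auto simp: nth_default_nth)
      ultimately show "F x n = w ! n" using Fx[OF u(1), of n] by (metis map_upt_prefix)
    qed
    then have "F x \<in> cylinder B w" using FB u(1) by (simp add: cylinder_def)
    then show "x \<in> seqs A - {x \<in> seqs A. F x \<in> Q}" using u(1,3) L(3) by blast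
  qed
  ultimately show ?thesis unfolding effectively_closed_def
    by (intro conjI exI[of _ L']) (simp_all add: L'_def Collect_conj_eq subset_iff)
qed

section \<open>Computable numberings of groups\<close>

subsection \<open>Words over the generators\<close>

locale finitely_generated_group = group G for G :: "('g, 'b) monoid_scheme" (structure) +
  fixes S :: "'g set"
  assumes finite_S: "finite S" and S_subset: "S \<subseteq> carrier G"
    and generate_S: "generate G S = carrier G"
begin

lemma letters_carrier: "letters G S \<subseteq> carrier G"
  unfolding letters_def using S_subset by auto

lemma finite_letters: "finite (letters G S)"
  unfolding letters_def using finite_S by simp

lemma inv_letters: "s \<in> letters G S \<Longrightarrow> inv s \<in> letters G S"
  unfolding letters_def using S_subset by auto

lemma word_value_Nil [simp]: "word_value G [] = \<one>"
  and word_value_Cons [simp]: "word_value G (s # w) = s \<otimes> word_value G w"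
  unfolding word_value_def by simp_all

lemma word_value_closed [simp]: "w \<in> lists (letters G S) \<Longrightarrow> word_value G w \<in> carrier G"
  by (induction w) (use letters_carrier in auto)

lemma word_value_append:
  "v \<in> lists (letters G S) \<Longrightarrow> w \<in> lists (letters G S) \<Longrightarrow>
    word_value G (v @ w) = word_value G v \<otimes> word_value G w"
  by (induction v) (use letters_carrier in \<open>auto simp: m_assoc subset_iff\<close>)

text \<open>Formal inverses of words turn the comparison of two words into an instance of the word problem.\<close>

lemma word_value_rev_inv:
  "w \<in> lists (letters G S) \<Longrightarrow> word_value G (rev (map (m_inv G) w)) = inv (word_value G w)"
proof (induction w)
  case (Cons s w)
  then have "rev (map (m_inv G) w) \<in> lists (letters G S)" using inv_letters by auto
  then have "word_value G (rev (map (m_inv G) w) @ [inv s]) = inv (word_value G w) \<otimes> inv s"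
    using Cons inv_letters letters_carrier by (subst word_value_append) (auto simp: subset_iff)
  then show ?case using Cons letters_carrier by (auto simp: inv_mult_group subset_iff)
qed simp

lemma word_exists:
  assumes "g \<in> carrier G"
  obtains w where "w \<in> lists (letters G S)" "word_value G w = g"
proof -
  have "g \<in> generate G S" using assms generate_S by simp
  then have "\<exists>w. w \<in> lists (letters G S) \<and> word_value G w = g"
  proof induction
    case one
    show ?case by (rule exI[of _ "[]"]) simp
  next
    case (incl h)
    then show ?case using S_subset by (intro exI[of _ "[h]"]) (auto simp: letters_def)
  next
    case (inv h)
    then show ?case using S_subset by (intro exI[of _ "[inv h]"]) (auto simp: letters_def)
  next
    case (eng h k)
    then obtain v w where "v \<in> lists (letters G S)" "word_value G v = h"
      "w \<in> lists (letters G S)" "word_value G w = k" by blast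
    then show ?case by (intro exI[of _ "v @ w"]) (auto simp: word_value_append)
  qed
  with that show ?thesis by blast
qed

lemma letter_numbering_exists: "\<exists>e :: 'g \<Rightarrow> nat. inj_on e (letters G S)"
  using finite_imp_inj_to_nat_seg[OF finite_letters] by blast

end

subsection \<open>A numbering from a decision procedure for the word problem\<close>

lemma computable_enumerate:
  fixes A :: "nat set"
  assumes "computable (\<lambda>n. n \<in> A)" "infinite A"
  shows "computable (enumerate A)"
proof (rule computable_cong)
  have "computable (\<lambda>p. snd p \<in> A \<and> fst p < (snd p :: nat))"
    by (intro comp_intros computable_compose[OF assms(1)])
  then have step: "computable (\<lambda>r. LEAST s. s \<in> A \<and> r < s)"
    by (rule computable_Least) (use assms(2) infinite_nat_iff_unbounded in blast)
  show "computable (\<lambda>n. rec_nat (LEAST n. n \<in> A) (\<lambda>_ r. LEAST s. s \<in> A \<and> r < s) n)"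
    by (intro comp_intros computable_compose[OF step])
  show "enumerate A n = rec_nat (LEAST n. n \<in> A) (\<lambda>_ r. LEAST s. s \<in> A \<and> r < s) n" for n
    by (induction n) (simp_all add: enumerate_0 enumerate_Suc'' assms(2))
qed

text \<open>The word problem decides whether two words have the same value, hence whether a code is the least
  one for its element. The \<open>n\<close>-th element of the group is represented by the \<open>n\<close>-th such code. To
  multiply, concatenate the representing words and search for the representative of the result.\<close>

lemma (in finitely_generated_group) computable_numbering_exists:
  assumes "infinite (carrier G)" "decidable_word_problem G S"
  shows "\<exists>\<nu>. computable_numbering G \<nu>"
proof -
  obtain e :: "'g \<Rightarrow> nat" where e: "inj_on e (letters G S)" and dec: "decidable_set ((\<lambda>w. list_encode (map e w)) `
        {w \<in> lists (letters G S). word_value G w = \<one>})"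
    using assms(2) unfolding decidable_word_problem_def by blast
  define D where "D = (\<lambda>w. list_encode (map e w)) ` {w \<in> lists (letters G S). word_value G w = \<one>}"
  have "computable (\<lambda>n. if n \<in> D then 1 else 0 :: nat)"
    using dec unfolding decidable_set_def D_def by (intro partrec_imp_computable) simp
  then have "computable (\<lambda>n. (if n \<in> D then 1 else 0 :: nat) = 1)"
    by (rule computable_eq[OF _ computable_const])
  then have D: "computable (\<lambda>n. n \<in> D)" by (rule computable_cong) simp
  define \<Lambda> where "\<Lambda> = e ` letters G S"
  have fin: "finite \<Lambda>" using finite_letters by (simp add: \<Lambda>_def)
  define word where "word n = map (inv_into (letters G S) e) (list_decode n)" for n
  define valid where "valid n \<longleftrightarrow> (\<forall>a\<in>set (list_decode n). a \<in> \<Lambda>)" for n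
  define val where "val n = word_value G (word n)" for n
  have word: "word n \<in> lists (letters G S)" if "valid n" for n
    using that inv_into_into[of _ e "letters G S"] unfolding valid_def word_def \<Lambda>_def by auto
  have e_word: "map e (word n) = list_decode n" if "valid n" for n
    using that unfolding valid_def word_def \<Lambda>_def by (auto simp: f_inv_into_f intro!: map_idI)
  have word_e: "word (list_encode (map e w)) = w" "valid (list_encode (map e w))"
    if "w \<in> lists (letters G S)" for w
    using that e by (auto simp: word_def valid_def \<Lambda>_def intro!: map_idI)
  have trivial_iff: "n \<in> D \<longleftrightarrow> val n = \<one>" if "valid n" for n
  proof
    assume "n \<in> D"
    then obtain w where w: "w \<in> lists (letters G S)" "word_value G w = \<one>" "n = list_encode (map e w)"
      unfolding D_def by blast
    show "val n = \<one>" unfolding val_def w(3) word_e(1)[OF w(1)] by (rule w(2))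
  next
    assume "val n = \<one>"
    then show "n \<in> D" unfolding D_def val_def using word[OF that] e_word[OF that]
      by (intro image_eqI[of _ _ "word n"]) auto
  qed
  obtain i where i: "computable i" "\<And>a. a \<in> \<Lambda> \<Longrightarrow> i a = e (inv (inv_into (letters G S) e a))"
    by (rule computable_on_finite[OF fin, of "\<lambda>a. e (inv (inv_into (letters G S) e a))"]) blast
  define quot where "quot n k = list_encode (list_decode n @ rev (map i (list_decode k)))" for n k
  have quot: "valid (quot n k)" "val (quot n k) = val n \<otimes> inv (val k)" if v: "valid n" "valid k" for n k
  proof -
    have "rev (map (m_inv G) (word k)) \<in> lists (letters G S)" using word[OF v(2)] inv_letters by auto
    moreover have "map i (list_decode k) = map e (map (m_inv G) (word k))"
      using v(2) i(2) unfolding word_def valid_def by auto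
    then have "quot n k = list_encode (map e (word n @ rev (map (m_inv G) (word k))))"
      unfolding quot_def using e_word[OF v(1)] by (simp add: rev_map)
    moreover note word[OF v(1)] word[OF v(2)]
    ultimately show "valid (quot n k)" "val (quot n k) = val n \<otimes> inv (val k)"
      unfolding val_def by (auto simp: word_e word_value_append word_value_rev_inv simp del: map_append)
  qed
  have val_closed: "val n \<in> carrier G" if "valid n" for n
    unfolding val_def using word[OF that] by simp
  have same_iff: "quot n k \<in> D \<longleftrightarrow> val n = val k" if "valid n" "valid k" for n k
    using quot[OF that] val_closed that trivial_iff[of "quot n k"]
    by (metis inv_equality inv_inv inv_closed r_inv)
  have quot_comp: "computable (\<lambda>x. quot (f x) (g x))" if "computable f" "computable g"
    for f g :: "'x::enc \<Rightarrow> nat"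
    unfolding quot_def by (intro comp_intros that computable_compose[OF i(1)])
  have valid_comp: "computable valid"
    unfolding valid_def by (intro comp_intros computable_member_finite fin)
  \<comment> \<open>Every element is represented by the least code of a word for it.\<close>
  define R where "R = {n. valid n \<and> (\<forall>k<n. valid k \<longrightarrow> quot k n \<notin> D)}"
  have R_comp: "computable (\<lambda>n. n \<in> R)"
    unfolding R_def mem_Collect_eq
    by (intro comp_intros computable_compose[OF valid_comp] computable_compose[OF D] quot_comp)
  have R_valid: "valid n" if "n \<in> R" for n using that by (simp add: R_def)
  have "bij_betw val R (carrier G)"
  proof (rule bij_betwI')
    show "val n = val k \<longleftrightarrow> n = k" if "n \<in> R" "k \<in> R" for n k
    proof
      assume "val n = val k"
      then have "quot n k \<in> D" "quot k n \<in> D" using that R_valid same_iff by auto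
      then show "n = k" using that unfolding R_def by (metis (mono_tags, lifting) linorder_neqE_nat mem_Collect_eq)
    qed simp
    show "val n \<in> carrier G" if "n \<in> R" for n using that val_closed R_valid by blast
    show "\<exists>n\<in>R. g = val n" if "g \<in> carrier G" for g
    proof -
      obtain w where "w \<in> lists (letters G S)" "word_value G w = g" using word_exists[OF \<open>g \<in> carrier G\<close>] .
      then have ex: "\<exists>n. valid n \<and> val n = g" using word_e unfolding val_def by metis
      define n where "n = (LEAST n. valid n \<and> val n = g)"
      have n: "valid n \<and> val n = g" unfolding n_def using ex by (rule LeastI_ex)
      have "\<not> (valid k \<and> val k = g)" if "k < n" for k using not_less_Least that unfolding n_def by blast
      then have "n \<in> R" unfolding R_def using n same_iff by auto
      with n show ?thesis by blast
    qed
  qed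
  then have "infinite R" using assms(1) bij_betw_finite by blast
  then have "bij_betw (enumerate R) UNIV R" by (rule bij_enumerate)
  define \<nu> where "\<nu> = val \<circ> enumerate R"
  have \<nu>: "bij_betw \<nu> UNIV (carrier G)"
    unfolding \<nu>_def by (rule bij_betw_trans) fact+
  have enum_R: "enumerate R n \<in> R" for n using \<open>infinite R\<close> by (rule enumerate_in_set)
  define cat where "cat i j = list_encode (list_decode (enumerate R i) @ list_decode (enumerate R j))" for i j
  have cat: "valid (cat i j)" "val (cat i j) = \<nu> i \<otimes> \<nu> j" for i j
  proof -
    have v: "valid (enumerate R i)" "valid (enumerate R j)" using enum_R R_valid by auto
    have c: "cat i j = list_encode (map e (word (enumerate R i) @ word (enumerate R j)))"
      unfolding cat_def using v by (simp add: e_word)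
    show "valid (cat i j)" "val (cat i j) = \<nu> i \<otimes> \<nu> j"
      using word[OF v(1)] word[OF v(2)] unfolding c val_def \<nu>_def
      by (auto simp: word_e word_value_append simp del: map_append)
  qed
  have \<nu>_closed: "\<nu> i \<in> carrier G" for i using \<nu> by (auto simp: bij_betw_def)
  have search: "quot (enumerate R k) (cat i j) \<in> D \<longleftrightarrow> \<nu> k = \<nu> i \<otimes> \<nu> j" for i j k
    using same_iff[OF R_valid[OF enum_R] cat(1)] unfolding cat(2) by (simp add: \<nu>_def)
  have index: "\<nu> k = g \<longleftrightarrow> k = inv_into UNIV \<nu> g" if "g \<in> carrier G" for k g
    using \<nu> that by (auto simp: bij_betw_def f_inv_into_f)
  define p where "p q = (LEAST k. quot (enumerate R k) (cat (fst q) (snd q)) \<in> D)" for q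
  have p_eq: "p (i, j) = inv_into UNIV \<nu> (\<nu> i \<otimes> \<nu> j)" for i j
    unfolding p_def search fst_conv snd_conv using index[of "\<nu> i \<otimes> \<nu> j"] \<nu>_closed
    by (intro Least_equality) auto
  have p: "computable p" unfolding p_def
  proof (rule computable_Least)
    show "computable (\<lambda>p. quot (enumerate R (snd p)) (cat (fst (fst p)) (snd (fst p))) \<in> D)"
      unfolding cat_def
      by (intro comp_intros quot_comp computable_compose[OF D]
          computable_compose[OF computable_enumerate[OF R_comp \<open>infinite R\<close>]])
    show "\<exists>k. quot (enumerate R k) (cat (fst q) (snd q)) \<in> D" for q
      unfolding search using index \<nu>_closed by (metis m_closed)
  qed
  have "computable (\<lambda>n. p (prod_decode n))" by (intro computable_compose[OF p] comp_intros)
  from computable_imp_partrec[OF this]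
  have "partrec (\<lambda>n. case prod_decode n of (i, j) \<Rightarrow> Some (inv_into UNIV \<nu> (\<nu> i \<otimes> \<nu> j)))"
    by (simp add: case_prod_beta flip: p_eq)
  with \<nu> show ?thesis unfolding computable_numbering_def by blast
qed

subsection \<open>The group structure on the numbers\<close>

text \<open>The group operation transported to the numbers, which is what an algorithm sees of the group.\<close>

locale nat_group =
  fixes mul :: "nat \<Rightarrow> nat \<Rightarrow> nat" (infixl "\<cdot>" 70) and unit :: nat and inverse_of :: "nat \<Rightarrow> nat"
  assumes mul_assoc: "(i \<cdot> j) \<cdot> k = i \<cdot> (j \<cdot> k)"
    and unit_mul [simp]: "unit \<cdot> i = i" and mul_unit [simp]: "i \<cdot> unit = i"
    and inverse_mul [simp]: "inverse_of i \<cdot> i = unit" and mul_inverse [simp]: "i \<cdot> inverse_of i = unit"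
    and computable_mul_pair: "computable (\<lambda>p. fst p \<cdot> snd p)"
begin

lemma inverse_mul_cancel [simp]: "inverse_of i \<cdot> (i \<cdot> j) = j"
  and mul_inverse_cancel [simp]: "i \<cdot> (inverse_of i \<cdot> j) = j"
  by (simp_all flip: mul_assoc)

lemma mul_left_cancel [simp]: "i \<cdot> j = i \<cdot> k \<longleftrightarrow> j = k"
  by (metis inverse_mul_cancel)

lemma inverse_quotient: "inverse_of (inverse_of i \<cdot> j) = inverse_of j \<cdot> i"
proof -
  have "inverse_of i \<cdot> j \<cdot> (inverse_of j \<cdot> i) = unit" by (simp add: mul_assoc)
  then show ?thesis by (metis inverse_mul_cancel mul_unit)
qed

lemma computable_mul [comp_intros]:
  "computable f \<Longrightarrow> computable g \<Longrightarrow> computable (\<lambda>x. f x \<cdot> g x)"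
  by (drule (1) computable_pair, drule computable_compose[OF computable_mul_pair]) simp

lemma computable_inverse [comp_intros]:
  assumes "computable f" shows "computable (\<lambda>x. inverse_of (f x))"
proof (rule computable_compose[OF _ assms], rule computable_cong)
  show "computable (\<lambda>i. LEAST j. i \<cdot> j = unit)"
    by (rule computable_Least) (intro comp_intros, metis mul_inverse)
  show "inverse_of i = (LEAST j. i \<cdot> j = unit)" for i
    by (rule Least_equality[symmetric]) (simp, metis inverse_mul_cancel mul_unit order_refl)
qed

end

locale numbered_group = finitely_generated_group G S
  for G :: "('g, 'b) monoid_scheme" (structure) and S +
  fixes \<nu> :: "nat \<Rightarrow> 'g"
  assumes numbering: "computable_numbering G \<nu>"
begin

definition index :: "'g \<Rightarrow> nat" where "index = inv_into UNIV \<nu>"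

definition mul :: "nat \<Rightarrow> nat \<Rightarrow> nat" where "mul i j = index (\<nu> i \<otimes> \<nu> j)"

lemma bij_\<nu>: "bij_betw \<nu> UNIV (carrier G)"
  using numbering by (simp add: computable_numbering_def)

lemma \<nu>_closed [simp]: "\<nu> i \<in> carrier G"
  using bij_\<nu> by (auto simp: bij_betw_def)

lemma \<nu>_index [simp]: "g \<in> carrier G \<Longrightarrow> \<nu> (index g) = g"
  using bij_\<nu> by (auto simp: bij_betw_def index_def f_inv_into_f)

lemma index_\<nu> [simp]: "index (\<nu> i) = i"
  using bij_\<nu> by (auto simp: bij_betw_def index_def)

lemma \<nu>_mul: "\<nu> (mul i j) = \<nu> i \<otimes> \<nu> j"
  by (simp add: mul_def)

lemma \<nu>_eq_iff [simp]: "\<nu> i = \<nu> j \<longleftrightarrow> i = j"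
  by (metis index_\<nu>)

sublocale nat_group mul "index \<one>" "\<lambda>i. index (inv \<nu> i)"
proof
  have "computable (\<lambda>p. mul (fst p) (snd p))"
  proof (rule computableI)
    show "partrec (\<lambda>n. case prod_decode n of (i, j) \<Rightarrow> Some (inv_into UNIV \<nu> (\<nu> i \<otimes> \<nu> j)))"
      using numbering by (simp add: computable_numbering_def)
  qed (simp add: mul_def index_def case_prod_beta)
  then show "computable (\<lambda>p. mul (fst p) (snd p))" .
qed (simp_all add: mul_def m_assoc)

lemma delta_\<nu> [simp]: "delta G \<nu> x (\<nu> i) = x i"
  using index_\<nu>[of i] by (simp add: delta_def index_def)

end

section \<open>Effective subshifts and effectively closed sets\<close>

context finitely_generated_group
begin

lemma coded_pattern_eq_Some_iff:
  assumes "consistent G c"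
  shows "coded_pattern G c h = Some a \<longleftrightarrow> (\<exists>w. (w, a) \<in> c \<and> word_value G w = h)"
proof -
  have unique: "(THE b. \<exists>w. (w, b) \<in> c \<and> word_value G w = h) = a"
    if "(w, a) \<in> c" "word_value G w = h" for w a
    using assms that unfolding consistent_def by (intro the_equality) (blast, fastforce)
  show ?thesis
  proof
    assume "coded_pattern G c h = Some a"
    then obtain w b where "(w, b) \<in> c" "word_value G w = h"
      and "a = (THE b. \<exists>w. (w, b) \<in> c \<and> word_value G w = h)"
      unfolding coded_pattern_def by (auto split: if_splits)
    with unique show "\<exists>w. (w, a) \<in> c \<and> word_value G w = h" by auto
  next
    assume "\<exists>w. (w, a) \<in> c \<and> word_value G w = h"
    then obtain w where w: "(w, a) \<in> c" "word_value G w = h" by blast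
    then have "h \<in> word_value G ` fst ` c" by force
    with unique[OF w] show "coded_pattern G c h = Some a" unfolding coded_pattern_def by simp
  qed
qed

text \<open>Occurrence of a coded pattern, without reference to consistency: an inconsistent coding
  makes contradictory demands on a configuration and so occurs nowhere.\<close>

definition occurs :: "'g coding \<Rightarrow> ('g \<Rightarrow> nat) \<Rightarrow> bool" where
  "occurs c x \<longleftrightarrow> (\<exists>g\<in>carrier G. \<forall>w a. (w, a) \<in> c \<longrightarrow> x (g \<otimes> word_value G w) = a)"

lemma coding_word_closed:
  assumes "c \<subseteq> lists (letters G S) \<times> A" "(w, a) \<in> c" shows "word_value G w \<in> carrier G"
  by (rule word_value_closed) (use assms in blast)

text \<open>A pattern is found at \<open>g\<close> exactly when it is found at the identity after translating by
  \<open>inv g\<close>, because the action reads a configuration at inverse translates.\<close>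

lemma occurs_iff_appears:
  assumes c: "c \<subseteq> lists (letters G S) \<times> A"
  shows "occurs c x \<longleftrightarrow> consistent G c \<and> appears G (coded_pattern G c) x"
proof
  assume "occurs c x"
  then obtain g where g: "g \<in> carrier G" and x: "\<And>w a. (w, a) \<in> c \<Longrightarrow> x (g \<otimes> word_value G w) = a"
    unfolding occurs_def by blast
  have con: "consistent G c" unfolding consistent_def
  proof clarify
    fix v a w b assume "(v, a) \<in> c" "(w, b) \<in> c" "word_value G v = word_value G w"
    then show "a = b" using x[of v a] x[of w b] by simp
  qed
  have "(Some \<circ> shift G (inv g) x) |` dom (coded_pattern G c) = coded_pattern G c"
  proof
    fix h
    show "((Some \<circ> shift G (inv g) x) |` dom (coded_pattern G c)) h = coded_pattern G c h"
    proof (cases "coded_pattern G c h")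
      case (Some a)
      then obtain w where w: "(w, a) \<in> c" "word_value G w = h"
        using coded_pattern_eq_Some_iff[OF con] by blast
      then have "h \<in> carrier G" using coding_word_closed[OF c] by blast
      then show ?thesis using Some x[OF w(1)] w(2) g by (auto simp: restrict_map_def shift_def)
    qed (simp add: restrict_map_def dom_def)
  qed
  with con g show "consistent G c \<and> appears G (coded_pattern G c) x"
    unfolding appears_def by (intro conjI bexI[of _ "inv g"]) auto
next
  assume *: "consistent G c \<and> appears G (coded_pattern G c) x"
  then obtain g where g: "g \<in> carrier G"
    and eq: "(Some \<circ> shift G g x) |` dom (coded_pattern G c) = coded_pattern G c"
    unfolding appears_def by blast
  have "x (inv g \<otimes> word_value G w) = a" if w: "(w, a) \<in> c" for w a
  proof -
    have "coded_pattern G c (word_value G w) = Some a"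
      using * w coded_pattern_eq_Some_iff by blast
    moreover have "word_value G w \<in> carrier G" using coding_word_closed[OF c w] .
    ultimately show ?thesis
      using fun_cong[OF eq, of "word_value G w"] by (auto simp: shift_def restrict_map_def dom_def)
  qed
  with g show "occurs c x" unfolding occurs_def by (intro bexI[of _ "inv g"]) auto
qed

lemma subshift_of_eq:
  assumes "C \<subseteq> pattern_codings G S A"
  shows "subshift_of G A C = {x \<in> carrier G \<rightarrow>\<^sub>E A. \<forall>c\<in>C. \<not> occurs c x}"
proof -
  have "occurs c x \<longleftrightarrow> consistent G c \<and> appears G (coded_pattern G c) x" if "c \<in> C" for c x
    using assms that by (intro occurs_iff_appears[of _ A]) (auto simp: pattern_codings_def)
  then show ?thesis unfolding subshift_of_def by blast
qed

lemma occurs_shift: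
  assumes "c \<subseteq> lists (letters G S) \<times> A" "g \<in> carrier G" "occurs c (shift G g x)"
  shows "occurs c x"
proof -
  obtain h where h: "h \<in> carrier G"
    and *: "\<And>w a. (w, a) \<in> c \<Longrightarrow> shift G g x (h \<otimes> word_value G w) = a"
    using assms(3) unfolding occurs_def by blast
  have "x ((inv g \<otimes> h) \<otimes> word_value G w) = a" if "(w, a) \<in> c" for w a
  proof -
    have "word_value G w \<in> carrier G" using coding_word_closed[OF assms(1) that] .
    then show ?thesis using *[OF that] h assms(2) by (simp add: shift_def m_assoc)
  qed
  with h assms(2) show ?thesis unfolding occurs_def by (intro bexI[of _ "inv g \<otimes> h"]) auto
qed

lemma topspace_configs: "topspace (configs G A) = carrier G \<rightarrow>\<^sub>E A"
  by (simp add: configs_def)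

text \<open>An occurrence at a given place is a condition on finitely many coordinates.\<close>

lemma openin_occurs:
  assumes "finite c" "c \<subseteq> lists (letters G S) \<times> A"
  shows "openin (configs G A) {x \<in> carrier G \<rightarrow>\<^sub>E A. occurs c x}"
proof -
  have point: "openin (configs G A) {x \<in> topspace (configs G A). x h = a}" if "h \<in> carrier G" for h a
  proof -
    have "continuous_map (configs G A) (discrete_topology A) (\<lambda>x. x h)"
      unfolding configs_def by (rule continuous_map_product_projection[OF that])
    from openin_continuous_map_preimage[OF this, of "{a} \<inter> A"]
    show ?thesis using that by (auto elim!: back_subst[of "openin _"] simp: topspace_configs)
  qed
  have at: "openin (configs G A) {x \<in> topspace (configs G A).
      \<forall>w a. (w, a) \<in> c \<longrightarrow> x (g \<otimes> word_value G w) = a}"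
    if g: "g \<in> carrier G" for g
    using assms
  proof (induction c)
    case (insert p c)
    obtain w a where p: "p = (w, a)" by force
    have "word_value G w \<in> carrier G" using coding_word_closed[OF insert.prems(1)] p by blast
    with g have "openin (configs G A) {x \<in> topspace (configs G A). x (g \<otimes> word_value G w) = a}"
      by (intro point) simp
    from openin_Int[OF this insert.IH] insert.prems show ?case
      by (auto elim!: back_subst[of "openin _"] simp: p)
  qed simp
  have "{x \<in> carrier G \<rightarrow>\<^sub>E A. occurs c x} = (\<Union>g\<in>carrier G. {x \<in> topspace (configs G A).
      \<forall>w a. (w, a) \<in> c \<longrightarrow> x (g \<otimes> word_value G w) = a})"
    unfolding occurs_def topspace_configs by blast
  with at show ?thesis by (auto intro: openin_clauses(3))
qed

lemma subshift_subshift_of: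
  assumes "C \<subseteq> pattern_codings G S A"
  shows "subshift G A (subshift_of G A C)"
  unfolding subshift_def
proof (intro conjI ballI)
  have "openin (configs G A) (\<Union>c\<in>C. {x \<in> carrier G \<rightarrow>\<^sub>E A. occurs c x})"
    using assms by (intro openin_clauses(3)) (auto simp: pattern_codings_def intro!: openin_occurs)
  from closedin_diff[OF closedin_topspace this]
  have "closedin (configs G A) (topspace (configs G A) - (\<Union>c\<in>C. {x \<in> carrier G \<rightarrow>\<^sub>E A. occurs c x}))" .
  also have "topspace (configs G A) - (\<Union>c\<in>C. {x \<in> carrier G \<rightarrow>\<^sub>E A. occurs c x}) = subshift_of G A C"
    unfolding subshift_of_eq[OF assms] topspace_configs by blast
  finally show "closedin (configs G A) (subshift_of G A C)" .
  fix g x assume g: "g \<in> carrier G" and x: "x \<in> subshift_of G A C"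
  then have "shift G g x \<in> carrier G \<rightarrow>\<^sub>E A"
    unfolding subshift_of_eq[OF assms] by (auto simp: shift_def PiE_iff)
  moreover have "\<not> occurs c (shift G g x)" if "c \<in> C" for c
    using x that occurs_shift[OF _ g, of c A x] assms
    unfolding subshift_of_eq[OF assms] by (auto simp: pattern_codings_def)
  ultimately show "shift G g x \<in> subshift_of G A C" unfolding subshift_of_eq[OF assms] by blast
qed

end

context numbered_group
begin

text \<open>The word with code \<open>n\<close> represents the element with this number, if \<open>\<tau>\<close> translates the codes
  of letters to their numbers.\<close>

definition word_index :: "(nat \<Rightarrow> nat) \<Rightarrow> nat \<Rightarrow> nat" where
  "word_index \<tau> n = foldr (\<lambda>a r. mul (\<tau> a) r) (list_decode n) (index \<one>)"

lemma computable_word_index: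
  assumes "computable \<tau>" "computable f" shows "computable (\<lambda>x. word_index \<tau> (f x))"
  unfolding word_index_def by (intro comp_intros computable_compose[OF assms(1)] assms(2))

lemma letter_index_exists:
  assumes "inj_on e (letters G S)"
  obtains \<tau> where "computable \<tau>" "\<And>s. s \<in> letters G S \<Longrightarrow> \<tau> (e s) = index s"
proof -
  have "finite (e ` letters G S)" using finite_letters by simp
  then obtain \<tau> where "computable \<tau>"
    "\<And>a. a \<in> e ` letters G S \<Longrightarrow> \<tau> a = index (inv_into (letters G S) e a)"
    by (rule computable_on_finite[of _ "\<lambda>a. index (inv_into (letters G S) e a)"]) blast
  with that[of \<tau>] assms show ?thesis by simp
qed

lemma word_index_encode:
  assumes \<tau>: "\<And>s. s \<in> letters G S \<Longrightarrow> \<tau> (e s) = index s" and "w \<in> lists (letters G S)"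
  shows "word_index \<tau> (list_encode (map e w)) = index (word_value G w)"
  using assms(2)
proof (induction w)
  case (Cons s w)
  then have "s \<in> carrier G" "word_value G w \<in> carrier G" using letters_carrier by auto
  with Cons show ?case by (simp add: word_index_def \<tau> mul_def)
qed (simp add: word_index_def)

lemma delta_PiE_iff: "delta G \<nu> x \<in> carrier G \<rightarrow>\<^sub>E A \<longleftrightarrow> x \<in> seqs A"
proof
  assume *: "delta G \<nu> x \<in> carrier G \<rightarrow>\<^sub>E A"
  have "x i \<in> A" for i using PiE_mem[OF *, of "\<nu> i"] by simp
  then show "x \<in> seqs A" by (auto simp: seqs_def)
qed (auto simp: delta_def seqs_def)

text \<open>An occurrence of a pattern at \<open>\<nu> k\<close> concerns finitely many entries, and their numbers can be computed
  from \<open>k\<close> and the code of the pattern. So the words that exhibit an occurrence of a forbidden pattern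
  are enumerable along with the patterns.\<close>

lemma effective_subshift_vimage_effectively_closed:
  assumes A: "finite A" and X: "effective_subshift G S A X"
  shows "effectively_closed A (delta G \<nu> -` X)"
proof -
  obtain C e where C: "C \<subseteq> pattern_codings G S A" and e: "inj_on e (letters G S)"
    and enum: "comp_enumerable (coding_encode e ` C)" and X_eq: "X = subshift_of G A C"
    using X unfolding effective_subshift_def comp_enumerable_codings_def by blast
  obtain R where R: "computable R" and enum_eq: "coding_encode e ` C = {n. \<exists>s. R (n, s :: nat)}"
    using enum unfolding comp_enumerable_iff by blast
  from letter_index_exists[OF e] obtain \<tau> where \<tau>: "computable \<tau>"
    and \<tau>_e: "\<And>s. s \<in> letters G S \<Longrightarrow> \<tau> (e s) = index s" by blast
  have index_encode: "word_index \<tau> (list_encode (map e w)) = index (word_value G w)"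
    if "w \<in> lists (letters G S)" for w
    by (rule word_index_encode[OF _ that]) (rule \<tau>_e)
  \<comment> \<open>The word \<open>v\<close> shows an occurrence at \<open>\<nu> k\<close> of the pattern with code \<open>q\<close>.\<close>
  define shows_at where "shows_at v q k \<longleftrightarrow> (\<forall>p<q. odd (q div 2 ^ p) \<longrightarrow>
      mul k (word_index \<tau> (fst (prod_decode p))) < length v \<and>
      nth_default 0 v (mul k (word_index \<tau> (fst (prod_decode p)))) = snd (prod_decode p))"
    for v q k :: "_"
  have shows_at: "shows_at v (coding_encode e c) k \<longleftrightarrow>
      (\<forall>w a. (w, a) \<in> c \<longrightarrow>
        mul k (index (word_value G w)) < length v \<and> v ! mul k (index (word_value G w)) = a)"
    if "c \<in> C" for v c k
  proof -
    have c: "finite c" "c \<subseteq> lists (letters G S) \<times> A" using that C by (auto simp: pattern_codings_def)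
    have bound: "p < q" if "odd (q div 2 ^ p)" for p q :: nat
    proof -
      have "q div 2 ^ p \<noteq> 0" using that by (metis even_zero)
      then have "2 ^ p \<le> q" by (metis div_less not_le)
      then show ?thesis using less_exp[of p] by linarith
    qed
    have support: "{p. odd (coding_encode e c div 2 ^ p)} =
        (\<lambda>(w, a). prod_encode (list_encode (map e w), a)) ` c"
      using c(1) unfolding coding_encode_def set_decode_def[symmetric] by simp
    have bounded: "(\<forall>p<q. odd (q div 2 ^ p) \<longrightarrow> P p) \<longleftrightarrow> (\<forall>p\<in>{p. odd (q div 2 ^ p)}. P p)" for P q
      using bound by blast
    have image: "(\<forall>p\<in>(\<lambda>(w, a). F w a) ` c. P p) \<longleftrightarrow> (\<forall>w a. (w, a) \<in> c \<longrightarrow> P (F w a))"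
      for P and F :: "'g list \<Rightarrow> nat \<Rightarrow> nat"
      by auto
    have "shows_at v (coding_encode e c) k \<longleftrightarrow>
      (\<forall>w a. (w, a) \<in> c \<longrightarrow> mul k (word_index \<tau> (list_encode (map e w))) < length v \<and>
        nth_default 0 v (mul k (word_index \<tau> (list_encode (map e w)))) = a)"
      unfolding shows_at_def bounded support image by simp
    also have "\<dots> \<longleftrightarrow> (\<forall>w a. (w, a) \<in> c \<longrightarrow>
        mul k (index (word_value G w)) < length v \<and> v ! mul k (index (word_value G w)) = a)"
    proof -
      have "word_index \<tau> (list_encode (map e w)) = index (word_value G w)" if "(w, a) \<in> c" for w a
        using c(2) that by (intro index_encode) blast
      then show ?thesis by (metis nth_default_nth)
    qed
    finally show ?thesis .
  qed
  define L where "L = {v \<in> lists A. \<exists>c\<in>C. \<exists>k. shows_at v (coding_encode e c) k}"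
  have enumerable: "comp_enumerable (list_encode ` L)"
  proof -
    define R' where "R' p \<longleftrightarrow> (\<forall>a\<in>set (list_decode (fst p)). a \<in> A) \<and>
        R (nth_default 0 (fst (snd p)) 0, snd (snd p)) \<and>
        shows_at (list_decode (fst p)) (nth_default 0 (fst (snd p)) 0) (nth_default 0 (fst (snd p)) 1)"
      for p :: "nat \<times> nat list \<times> nat"
    have "computable R'" unfolding R'_def shows_at_def
      by (intro comp_intros computable_member_finite[OF A] computable_compose[OF R]
          computable_word_index \<tau>)
    moreover have "list_encode ` L = {n. \<exists>w s. R' (n, w, s)}"
    proof (intro equalityI subsetI)
      fix n assume "n \<in> list_encode ` L"
      then obtain v c k where v: "n = list_encode v" "v \<in> lists A" "c \<in> C" "shows_at v (coding_encode e c) k"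
        unfolding L_def by blast
      then obtain s where "R (coding_encode e c, s)" using enum_eq by blast
      with v have "R' (n, [coding_encode e c, k], s)" by (auto simp: R'_def nth_default_def)
      then show "n \<in> {n. \<exists>w s. R' (n, w, s)}" by blast
    next
      fix n assume "n \<in> {n. \<exists>w s. R' (n, w, s)}"
      then obtain q k s where *: "\<forall>a\<in>set (list_decode n). a \<in> A" "R (q, s)" "shows_at (list_decode n) q k"
        unfolding R'_def by auto
      then obtain c where "c \<in> C" "q = coding_encode e c" using enum_eq by blast
      with * have "list_decode n \<in> L" unfolding L_def by auto
      then show "n \<in> list_encode ` L" by (metis imageI list_decode_inverse)
    qed
    ultimately show ?thesis using comp_enumerableI by simp
  qed
  have occurs: "occurs c (delta G \<nu> x) \<longleftrightarrow>
      (\<exists>k. \<forall>w a. (w, a) \<in> c \<longrightarrow> x (mul k (index (word_value G w))) = a)"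
    if "c \<in> C" for c x
  proof -
    have *: "delta G \<nu> x (\<nu> k \<otimes> word_value G w) = x (mul k (index (word_value G w)))"
      if "(w, a) \<in> c" for k w a
    proof -
      have "word_value G w \<in> carrier G"
        by (rule word_value_closed) (use that \<open>c \<in> C\<close> C in \<open>auto simp: pattern_codings_def\<close>)
      then show ?thesis using delta_\<nu>[of x "mul k (index (word_value G w))"] by (simp add: \<nu>_mul)
    qed
    have "carrier G = range \<nu>" using bij_\<nu> by (simp add: bij_betw_def)
    then have "occurs c (delta G \<nu> x) \<longleftrightarrow> (\<exists>k. \<forall>w a. (w, a) \<in> c \<longrightarrow> delta G \<nu> x (\<nu> k \<otimes> word_value G w) = a)"
      unfolding occurs_def by simp
    then show ?thesis by (simp add: * cong: imp_cong)
  qed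
  have complement: "seqs A - delta G \<nu> -` X = (\<Union>v\<in>L. cylinder A v)"
  proof (intro equalityI subsetI)
    fix x assume x: "x \<in> seqs A - delta G \<nu> -` X"
    then obtain c where c: "c \<in> C" "occurs c (delta G \<nu> x)"
      using delta_PiE_iff unfolding X_eq subshift_of_eq[OF C] by blast
    then obtain k where k: "\<And>w a. (w, a) \<in> c \<Longrightarrow> x (mul k (index (word_value G w))) = a"
      using occurs by blast
    define l where "l = Suc (\<Sum>p\<in>c. mul k (index (word_value G (fst p))))"
    have "finite c" using c(1) C by (auto simp: pattern_codings_def)
    then have "mul k (index (word_value G w)) < l" if "(w, a) \<in> c" for w a
      using member_le_sum[OF that, of "\<lambda>p. mul k (index (word_value G (fst p)))"]
      unfolding l_def by simp
    with k have "shows_at (map x [0..<l]) (coding_encode e c) k"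
      unfolding shows_at[OF c(1)] by auto
    then have "map x [0..<l] \<in> L" unfolding L_def using c(1) x map_in_lists by blast
    moreover have "x \<in> cylinder A (map x [0..<l])" using x by (simp add: cylinder_def prefix_of_seq_def)
    ultimately show "x \<in> (\<Union>v\<in>L. cylinder A v)" by blast
  next
    fix x assume "x \<in> (\<Union>v\<in>L. cylinder A v)"
    then obtain v c k where x: "x \<in> seqs A" "prefix_of_seq v x" and c: "c \<in> C"
      and "shows_at v (coding_encode e c) k"
      unfolding L_def cylinder_def by blast
    then have "\<forall>w a. (w, a) \<in> c \<longrightarrow> x (mul k (index (word_value G w))) = a"
      unfolding shows_at[OF c] prefix_of_seq_iff by auto
    then have "occurs c (delta G \<nu> x)" using occurs[OF c] by blast
    then show "x \<in> seqs A - delta G \<nu> -` X" using x c unfolding X_eq subshift_of_eq[OF C] by blast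
  qed
  have inside: "delta G \<nu> -` X \<subseteq> seqs A"
    using delta_PiE_iff unfolding X_eq subshift_of_def by blast
  have words: "L \<subseteq> lists A" unfolding L_def by blast
  show ?thesis unfolding effectively_closed_def
    by (intro conjI exI[of _ L] inside words enumerable complement)
qed

text \<open>Conversely, words are forbidden along the numbering from every position. Replacing the numbers by
  words for the elements, found by search, makes a forbidden word a pattern coding.\<close>

lemma effective_subshift_of_words:
  assumes L: "L \<subseteq> lists A" and enum: "comp_enumerable (list_encode ` L)"
  shows "effective_subshift G S A
    {x \<in> carrier G \<rightarrow>\<^sub>E A. \<forall>g\<in>carrier G. \<forall>v\<in>L. \<exists>i<length v. x (g \<otimes> \<nu> i) \<noteq> v ! i}"
proof -
  obtain e :: "'g \<Rightarrow> nat" where e: "inj_on e (letters G S)" using letter_numbering_exists by blast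
  from letter_index_exists[OF e] obtain \<tau> where \<tau>: "computable \<tau>"
    and \<tau>_e: "\<And>s. s \<in> letters G S \<Longrightarrow> \<tau> (e s) = index s" by blast
  have index_encode: "word_index \<tau> (list_encode (map e w)) = index (word_value G w)"
    if "w \<in> lists (letters G S)" for w
    by (rule word_index_encode[OF _ that]) (rule \<tau>_e)
  define valid where "valid i n \<longleftrightarrow> (\<forall>a\<in>set (list_decode n). a \<in> e ` letters G S) \<and> word_index \<tau> n = i"
    for i n
  \<comment> \<open>A pattern coding needs words, so each number is turned into the first word for its element.\<close>
  define code where "code i = (LEAST n. valid i n)" for i
  define word where "word i = map (inv_into (letters G S) e) (list_decode (code i))" for i
  have ex: "\<exists>n. valid i n" for i
  proof -
    obtain w where "w \<in> lists (letters G S)" "word_value G w = \<nu> i"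
      using word_exists[OF \<nu>_closed] .
    then show ?thesis unfolding valid_def
      by (intro exI[of _ "list_encode (map e w)"]) (auto simp: index_encode)
  qed
  then have code: "valid i (code i)" for i unfolding code_def by (rule LeastI_ex)
  have code_comp: "computable code" unfolding code_def
    by (rule computable_Least) (unfold valid_def, intro comp_intros computable_member_finite
        computable_word_index \<tau>, simp add: finite_letters, fold valid_def, rule ex)
  have word: "word i \<in> lists (letters G S)" for i
    using code[of i] inv_into_into[of _ e "letters G S"] unfolding valid_def word_def by auto
  have e_word: "list_encode (map e (word i)) = code i" for i
    using code[of i] unfolding valid_def word_def by (simp add: f_inv_into_f map_idI)
  have word_value: "word_value G (word i) = \<nu> i" for i
  proof -
    have "index (word_value G (word i)) = i"
      using index_encode[OF word, of i] code[of i] unfolding e_word valid_def by simp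
    then show ?thesis using \<nu>_index word word_value_closed by metis
  qed
  have inj: "inj code" using e_word word_value by (metis injI \<nu>_eq_iff code valid_def)
  define pat where "pat v = (\<lambda>i. (word i, v ! i)) ` {..<length v}" for v :: "nat list"
  define C where "C = pat ` L"
  have C: "C \<subseteq> pattern_codings G S A"
    using L word unfolding C_def pat_def pattern_codings_def by (auto simp del: in_lists_conv_set simp: subset_iff in_lists_conv_set[of _ A])
  define \<kappa> where "\<kappa> v = (sum_list (map (\<lambda>i. 2 ^ prod_encode (code i, nth_default 0 v i)) [0..<length v]) :: nat)"
    for v :: "nat list"
  have pat_code: "coding_encode e (pat v) = \<kappa> v" for v
  proof -
    have "coding_encode e (pat v) = set_encode ((\<lambda>i. prod_encode (code i, v ! i)) ` {..<length v})"
      unfolding coding_encode_def pat_def image_image by (simp add: e_word)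
    also have "\<dots> = (\<Sum>i<length v. 2 ^ prod_encode (code i, v ! i))"
      unfolding set_encode_def
      by (subst sum.reindex) (use inj in \<open>auto simp: inj_on_def o_def\<close>)
    also have "\<dots> = \<kappa> v"
      unfolding \<kappa>_def by (auto simp: sum_list_distinct_conv_sum_set nth_default_nth atLeast0LessThan intro!: sum.cong)
    finally show ?thesis .
  qed
  obtain R where R: "computable R" and R_iff: "\<And>w. w \<in> L \<longleftrightarrow> (\<exists>s. R (w, s :: nat))"
    using enum unfolding comp_enumerable_words_iff by blast
  have "computable (\<lambda>p. R (snd p) \<and> fst p = \<kappa> (fst (snd p)))"
    unfolding \<kappa>_def by (intro comp_intros computable_compose[OF R] computable_compose[OF code_comp])
  from comp_enumerableI[OF this]
  have "comp_enumerable {n. \<exists>w s. R (w, s) \<and> n = \<kappa> w}" by simp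
  also have "{n. \<exists>w s. R (w, s) \<and> n = \<kappa> w} = coding_encode e ` C"
    unfolding C_def image_image pat_code using R_iff by blast
  finally have "comp_enumerable_codings G S C"
    unfolding comp_enumerable_codings_def using e by blast
  moreover have "occurs (pat v) x \<longleftrightarrow> (\<exists>g\<in>carrier G. \<forall>i<length v. x (g \<otimes> \<nu> i) = v ! i)" for v x
  proof -
    have "(\<forall>w a. (w, a) \<in> (\<lambda>i. (word i, v ! i)) ` {..<length v} \<longrightarrow> P w a) \<longleftrightarrow>
        (\<forall>i<length v. P (word i) (v ! i))" for P
      by blast
    then show ?thesis unfolding occurs_def pat_def by (simp add: word_value)
  qed
  then have "subshift_of G A C =
      {x \<in> carrier G \<rightarrow>\<^sub>E A. \<forall>g\<in>carrier G. \<forall>v\<in>L. \<exists>i<length v. x (g \<otimes> \<nu> i) \<noteq> v ! i}"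
    unfolding subshift_of_eq[OF C] unfolding C_def by auto
  ultimately show ?thesis
    unfolding effective_subshift_def using C subshift_subshift_of[OF C] by (metis (no_types, lifting))
qed

end

section \<open>Binary sequences suffice\<close>

lemma nth_default_map_upt: "nth_default d (map f [0..<k]) i = (if i < k then f i else d)"
  by (simp add: nth_default_def)

text \<open>The letter \<open>a\<close> is written as a block of \<open>r\<close> bits whose only \<open>1\<close> is at position \<open>a\<close>. Decoding is total:
  a block that has no \<open>1\<close> at the position of a letter stands for a fixed letter \<open>a\<^sub>0\<close>. Hence the
  binary sequences that decode into \<open>X\<close> form a preimage under a functional.\<close>

lemma effectively_closed_binary_degree:
  assumes A: "finite A" and X: "effectively_closed A X" "X \<noteq> {}"
  obtains P where "effectively_closed {0, 1} P" "P \<noteq> {}" "medvedev_degree X = medvedev_degree P"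
proof -
  have XA: "X \<subseteq> seqs A" using X(1) by (simp add: effectively_closed_def)
  then obtain a\<^sub>0 where a\<^sub>0: "a\<^sub>0 \<in> A" using X(2) seqs_apply by blast
  define r where "r = Suc (Max A)"
  have r: "a < r" if "a \<in> A" for a using Max_ge[OF A that] by (simp add: r_def)
  have r_pos: "0 < r" by (simp add: r_def)
  define pos where "pos y i = (LEAST j. r \<le> j \<or> (j \<in> A \<and> y (r * i + j) = 1))"
    for y :: "nat \<Rightarrow> nat" and i
  \<comment> \<open>The search for a marked position stops at \<open>r\<close>, which then signals that there is none.\<close>
  define decode where "decode y i = (if pos y i < r then pos y i else a\<^sub>0)" for y i
  define encode where "encode x i = (if x (i div r) = i mod r then 1 else 0 :: nat)" for x :: "nat \<Rightarrow> nat" and i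
  have decode: "cfunctional {0, 1} A decode"
  proof (rule cfunctionalI)
    show "computable (\<lambda>p. decode (nth_default 0 (snd p)) (fst p))"
      unfolding decode_def pos_def
      by (intro comp_intros computable_Least computable_member_finite[OF A])
        (rule exI, rule disjI1, rule order_refl)+
    show "computable (\<lambda>i. r * i + r)" by (intro comp_intros)
    show "decode y \<in> seqs A" for y
    proof -
      have "decode y i \<in> A" for i
      proof (cases "pos y i < r")
        case True
        have "r \<le> pos y i \<or> (pos y i \<in> A \<and> y (r * i + pos y i) = 1)"
          unfolding pos_def by (rule LeastI[of _ r]) simp
        with True show ?thesis by (simp add: decode_def)
      qed (simp add: decode_def a\<^sub>0)
      then show ?thesis by (auto simp: seqs_def)
    qed
    show "decode y n = decode (nth_default 0 (snd (n, map y [0..<r * n + r]))) (fst (n, map y [0..<r * n + r]))" for y n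
    proof -
      have "(r \<le> j \<or> (j \<in> A \<and> y (r * n + j) = 1)) \<longleftrightarrow>
          (r \<le> j \<or> (j \<in> A \<and> nth_default 0 (map y [0..<r * n + r]) (r * n + j) = 1))" for j
        by (auto simp: nth_default_map_upt)
      then show ?thesis unfolding decode_def pos_def by simp
    qed
  qed
  have encode: "cfunctional A {0, 1} encode"
  proof (rule cfunctionalI)
    show "computable (\<lambda>p. encode (nth_default 0 (snd p)) (fst p))"
      unfolding encode_def by (intro comp_intros)
    show "computable (\<lambda>i. Suc (i div r))" by (intro comp_intros)
  qed (auto simp: encode_def seqs_def nth_default_map_upt simp del: upt_Suc)
  have decode_encode: "decode (encode x) = x" if "x \<in> seqs A" for x
  proof
    fix i
    have xi: "x i \<in> A" "x i < r" using seqs_apply[OF that, of i] r by auto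
    have *: "encode x (r * i + j) = 1 \<longleftrightarrow> x i = j" if "j < r" for j
      using that by (auto simp: encode_def)
    have "pos (encode x) i = x i"
      unfolding pos_def
    proof (intro Least_equality)
      show "x i \<le> j" if "r \<le> j \<or> (j \<in> A \<and> encode x (r * i + j) = 1)" for j
      proof (cases "j < r")
        case True
        with that *[OF True] show ?thesis by simp
      qed (use xi in simp)
    qed (use xi * in simp)
    then show "decode (encode x) i = x i" using xi by (simp add: decode_def)
  qed
  define P where "P = {y \<in> seqs {0, 1}. decode y \<in> X}"
  have P: "effectively_closed {0, 1} P"
    unfolding P_def by (rule effectively_closed_vimage[OF decode _ X(1)]) simp
  have enc_P: "encode x \<in> P" if "x \<in> X" for x
  proof -
    have "x \<in> seqs A" using XA that by blast
    with that show ?thesis unfolding P_def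
      using decode_encode cfunctional_seqs[OF encode] by simp
  qed
  have "medvedev_degree X = medvedev_degree P"
  proof (rule medvedev_degree_eqI)
    show "medvedev_le X P"
      by (rule medvedev_leI[OF decode]) (use A XA in \<open>auto simp: P_def\<close>)
    show "medvedev_le P X"
      by (rule medvedev_leI[OF encode]) (use A XA enc_P in \<open>auto simp: P_def\<close>)
  qed
  moreover have "P \<noteq> {}" using X(2) enc_P by blast
  ultimately show ?thesis using that P by blast
qed

section \<open>A shift-invariant code for sequences\<close>

context nat_group
begin

subsection \<open>Nested separated nets\<close>

text \<open>A bound for all products and quotients of two numbers below \<open>k\<close>. Initial segments of the numbers
  play the role of balls in the group, and \<open>spread\<close> that of doubling the radius.\<close>

definition spread :: "nat \<Rightarrow> nat" where
  "spread k = Suc k + sum_list (map (\<lambda>i. sum_list (map (\<lambda>j.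
    i \<cdot> j + inverse_of i \<cdot> j + i \<cdot> inverse_of j) [0..<k])) [0..<k])"

lemma spread_gt: "k < spread k"
  by (simp add: spread_def)

lemma less_spread:
  assumes "i < k" "j < k"
  shows "i \<cdot> j < spread k" "inverse_of i \<cdot> j < spread k" "i \<cdot> inverse_of j < spread k"
proof -
  let ?f = "\<lambda>i j. i \<cdot> j + inverse_of i \<cdot> j + i \<cdot> inverse_of j"
  have "?f i j \<le> sum_list (map (?f i) [0..<k])"
    using assms by (intro member_le_sum_list) auto
  also have "\<dots> \<le> sum_list (map (\<lambda>i. sum_list (map (?f i) [0..<k])) [0..<k])"
    using assms by (intro member_le_sum_list) auto
  also have "\<dots> < spread k" by (simp add: spread_def)
  finally show "i \<cdot> j < spread k" "inverse_of i \<cdot> j < spread k" "i \<cdot> inverse_of j < spread k" by auto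
qed

lemma computable_spread [comp_intros]: "computable f \<Longrightarrow> computable (\<lambda>x. spread (f x))"
  by (rule computable_compose[of spread]) (unfold spread_def, intro comp_intros)

text \<open>Three scales for each \<open>n\<close>. Within \<open>gap n\<close> of every element there is a point of the net \<open>n\<close>. Within
  \<open>near_bound n\<close> of every point of the net \<open>n + 1\<close> there is another point of the net \<open>n\<close>; this needs
  one element beyond the first \<open>gap n\<close>, hence the successor. Points of the net \<open>n + 1\<close> are
  \<open>separation n\<close> apart, so that their neighbourhoods of radius \<open>near_bound n\<close> are disjoint.
  Maximality of the net \<open>n + 1\<close> in the net \<open>n\<close> then yields the next gap: one \<open>spread\<close> turns closeness in
  one direction into closeness in the other, and a second one adds the two distances.\<close>

primrec gap :: "nat \<Rightarrow> nat" where
  "gap 0 = Suc unit"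
| "gap (Suc n) = spread (spread (spread (spread (Suc (gap n)))))"

definition near_bound :: "nat \<Rightarrow> nat" where "near_bound n = spread (Suc (gap n))"

definition separation :: "nat \<Rightarrow> nat" where "separation n = spread (near_bound n)"

lemma gap_Suc_eq: "gap (Suc n) = spread (spread (separation n))"
  by (simp add: separation_def near_bound_def)

lemma gap_less_near: "gap n < near_bound n"
  using spread_gt[of "Suc (gap n)"] by (simp add: near_bound_def)

lemma near_less_separation: "near_bound n < separation n"
  by (simp add: separation_def spread_gt)

lemma separation_less_gap: "separation n < gap (Suc n)"
  unfolding gap_Suc_eq by (rule less_trans[OF spread_gt spread_gt])

lemma gap_mono: "m \<le> n \<Longrightarrow> gap m \<le> gap n"
proof (rule lift_Suc_mono_le[of gap])
  show "gap n \<le> gap (Suc n)" for n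
    using gap_less_near[of n] near_less_separation[of n] separation_less_gap[of n] by linarith
qed

lemma le_gap: "n < gap n"
proof (induction n)
  case (Suc n)
  then show ?case
    using gap_less_near[of n] near_less_separation[of n] separation_less_gap[of n] by linarith
qed simp

lemma unit_less_gap: "unit < gap n"
  using gap_mono[of 0 n] by simp

lemma computable_gap [comp_intros]:
  assumes "computable f" shows "computable (\<lambda>x. gap (f x))"
proof (rule computable_compose[OF _ assms], rule computable_cong)
  show "computable (\<lambda>n. rec_nat (Suc unit) (\<lambda>_ r. spread (spread (spread (spread (Suc r))))) n)"
    by (intro comp_intros)
  show "gap n = rec_nat (Suc unit) (\<lambda>_ r. spread (spread (spread (spread (Suc r))))) n" for n
    by (induction n) simp_all
qed

lemma computable_near_bound [comp_intros]:
  "computable f \<Longrightarrow> computable (\<lambda>x. near_bound (f x))"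
  unfolding near_bound_def by (intro comp_intros)

lemma computable_separation [comp_intros]:
  "computable f \<Longrightarrow> computable (\<lambda>x. separation (f x))"
  unfolding separation_def by (intro comp_intros)

definition close :: "nat \<Rightarrow> nat \<Rightarrow> nat \<Rightarrow> bool" where
  "close n g h \<longleftrightarrow> inverse_of g \<cdot> h < separation n \<or> inverse_of h \<cdot> g < separation n"

lemma close_sym: "close n g h \<longleftrightarrow> close n h g"
  unfolding close_def by blast

text \<open>The number \<open>0\<close>, which is in all nets, keeps every other \<open>h\<close> out of the net \<open>h + 1\<close>. Hence every other number has
  a level, and this level is at most the number itself (\<open>level_le\<close>), so the \<open>g\<close>-th symbol of a code
  for \<open>y\<close> depends on the first \<open>g + 1\<close> entries of \<open>y\<close>.\<close>

lemma close_zero: "h \<le> n \<Longrightarrow> close n 0 h"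
proof -
  assume "h \<le> n"
  then have "0 < near_bound n" "h < near_bound n"
    using le_gap[of n] gap_less_near[of n] by linarith+
  then show ?thesis unfolding close_def separation_def using less_spread(2) by blast
qed

lemma computable_close [comp_intros]:
  "computable f \<Longrightarrow> computable g \<Longrightarrow> computable h \<Longrightarrow> computable (\<lambda>x. close (f x) (g x) (h x))"
  unfolding close_def by (intro comp_intros)

text \<open>All nets are constructed greedily at once. The list contains the levels of the numbers below \<open>g\<close>; the
  level of \<open>g\<close> is the last net that contains \<open>g\<close>, and \<open>g\<close> is excluded from the net \<open>n + 1\<close> by a
  smaller number of this net that is close to it. The number \<open>0\<close> has no level; it has the entry \<open>0\<close>
  in the list and is treated separately. The alternative \<open>g \<le> n\<close> stops the search for \<open>g = 0\<close>, and for
  all other \<open>g\<close> it changes nothing, by \<open>close_zero\<close>.\<close>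

definition next_level :: "nat \<Rightarrow> nat list \<Rightarrow> nat" where
  "next_level g ls = (LEAST n. g \<le> n \<or> (\<exists>h<g. (h = 0 \<or> n < nth_default 0 ls h) \<and> close n h g))"

primrec levels :: "nat \<Rightarrow> nat list" where
  "levels 0 = []"
| "levels (Suc g) = levels g @ [next_level g (levels g)]"

definition level :: "nat \<Rightarrow> nat" where "level g = next_level g (levels g)"

definition net :: "nat \<Rightarrow> nat \<Rightarrow> bool" where
  "net n g \<longleftrightarrow> g = 0 \<or> n \<le> level g"

lemma levels_eq: "levels g = map level [0..<g]"
  by (induction g) (simp_all add: level_def)

lemma level_eq: "level g = (LEAST n. g \<le> n \<or> (\<exists>h<g. net (Suc n) h \<and> close n h g))"
proof -
  have "(\<exists>h<g. (h = 0 \<or> n < nth_default 0 (levels g) h) \<and> close n h g) \<longleftrightarrow>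
      (\<exists>h<g. net (Suc n) h \<and> close n h g)" for n
    unfolding levels_eq net_def by (auto simp: nth_default_map_upt Suc_le_eq)
  then show ?thesis unfolding level_def[of g] next_level_def by simp
qed

lemma level_le: "level g \<le> g"
  unfolding level_eq by (rule Least_le) simp

lemma net_0: "net 0 g" and net_Suc: "net (Suc n) g \<Longrightarrow> net n g"
  by (auto simp: net_def)

lemma net_separated:
  assumes "net (Suc n) g" "net (Suc n) h" "close n g h" shows "g = h"
proof -
  have "\<not> close n h g" if "h < g" "net (Suc n) g" "net (Suc n) h" for g h
  proof -
    have "n < level g" using that by (auto simp: net_def)
    from not_less_Least[OF this[unfolded level_eq]] that show ?thesis by blast
  qed
  with assms close_sym show ?thesis by (metis linorder_neqE_nat)
qed

lemma net_maximal:
  assumes "net n g" "\<not> net (Suc n) g"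
  shows "\<exists>h. net (Suc n) h \<and> close n h g"
proof -
  have "g \<noteq> 0" "level g = n" using assms by (auto simp: net_def)
  then have "g \<le> n \<or> (\<exists>h<g. net (Suc n) h \<and> close n h g)"
    using LeastI[of "\<lambda>n. g \<le> n \<or> (\<exists>h<g. net (Suc n) h \<and> close n h g)" g] unfolding level_eq by auto
  then show ?thesis using close_zero by (auto simp: net_def)
qed

lemma computable_level [comp_intros]:
  assumes "computable f" shows "computable (\<lambda>x. level (f x))"
proof (rule computable_compose[OF _ assms])
  have next_comp: "computable (\<lambda>x. next_level (f x) (l x))" if "computable f" "computable l"
    for f :: "'x::enc \<Rightarrow> nat" and l
    unfolding next_level_def
    by (intro comp_intros computable_Least computable_compose[OF that(1)] computable_compose[OF that(2)])
      (rule exI, rule disjI1, rule order_refl)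
  have "computable (\<lambda>g. rec_nat [] (\<lambda>g ls. ls @ [next_level g ls]) g)"
    by (intro comp_intros next_comp)
  then have "computable levels"
  proof (rule computable_cong)
    show "levels g = rec_nat [] (\<lambda>g ls. ls @ [next_level g ls]) g" for g
      by (induction g) simp_all
  qed
  then show "computable level" unfolding level_def by (intro next_comp comp_intros)
qed

lemma computable_net [comp_intros]:
  "computable f \<Longrightarrow> computable g \<Longrightarrow> computable (\<lambda>x. net (f x) (g x))"
  unfolding net_def by (intro comp_intros)

text \<open>From a point of the net \<open>n\<close> that is near \<open>g\<close>, maximality leads to a point of the next net.\<close>

lemma net_gap: "\<exists>i<gap n. net n (g \<cdot> i)"
proof (induction n)
  case 0
  show ?case by (rule exI[of _ unit]) (simp add: net_0)
next
  case (Suc n)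
  then obtain i where i: "i < gap n" "net n (g \<cdot> i)" by blast
  have bounds: "i < spread (separation n)" "unit < separation n" "separation n < spread (separation n)"
    using i(1) gap_less_near[of n] near_less_separation[of n] spread_gt[of "separation n"] unit_less_gap[of n]
    by linarith+
  have "\<exists>j<spread (separation n). net (Suc n) (g \<cdot> i \<cdot> j)"
  proof (cases "net (Suc n) (g \<cdot> i)")
    case True
    then show ?thesis using bounds by (intro exI[of _ unit]) auto
  next
    case False
    then obtain h where h: "net (Suc n) h" "close n h (g \<cdot> i)" using net_maximal i(2) by blast
    let ?j = "inverse_of (g \<cdot> i) \<cdot> h"
    have inv: "?j = inverse_of (inverse_of h \<cdot> (g \<cdot> i))"
      by (rule inverse_quotient[symmetric])
    have "?j < spread (separation n)"
    proof (cases "?j < separation n")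
      case False
      with h(2) have "inverse_of h \<cdot> (g \<cdot> i) < separation n" by (simp add: close_def)
      from less_spread(2)[OF this bounds(2)] show ?thesis unfolding inv by simp
    qed (use bounds in linarith)
    moreover have "net (Suc n) (g \<cdot> i \<cdot> ?j)" using h(1) by simp
    ultimately show ?thesis by blast
  qed
  then obtain j where j: "j < spread (separation n)" "net (Suc n) (g \<cdot> i \<cdot> j)" by blast
  have "i \<cdot> j < gap (Suc n)" unfolding gap_Suc_eq by (rule less_spread(1)[OF bounds(1) j(1)])
  with j(2) show ?case by (auto simp: mul_assoc)
qed

definition layer :: "nat \<Rightarrow> nat \<Rightarrow> bool" where
  "layer n g \<longleftrightarrow> net n g \<and> \<not> net (Suc n) g"

lemma layer_iff: "layer n g \<longleftrightarrow> g \<noteq> 0 \<and> level g = n"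
  by (auto simp: layer_def net_def)

text \<open>Let \<open>t\<close> be the inverse of the number \<open>gap n\<close>. The element \<open>c \<cdot> t\<close> has a point \<open>c \<cdot> t \<cdot> k\<close> of the
  net \<open>n\<close> with \<open>k < gap n\<close> near it. This point is not \<open>c\<close>, as \<open>t \<cdot> k\<close> is the unit only for
  \<open>k = gap n\<close>. It is close to \<open>c\<close>, so by separation it is not in the net \<open>n + 1\<close>.\<close>

lemma layer_near_net:
  assumes "net (Suc n) c" shows "\<exists>j<near_bound n. layer n (c \<cdot> j)"
proof -
  let ?t = "gap n"
  obtain k where k: "k < gap n" "net n (c \<cdot> inverse_of ?t \<cdot> k)" using net_gap by blast
  let ?j = "inverse_of ?t \<cdot> k"
  have j: "?j < near_bound n" unfolding near_bound_def using k(1) by (intro less_spread(2)) auto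
  have "\<not> net (Suc n) (c \<cdot> ?j)"
  proof
    assume "net (Suc n) (c \<cdot> ?j)"
    moreover have "close n c (c \<cdot> ?j)" using j near_less_separation[of n] by (simp add: close_def)
    ultimately have "c = c \<cdot> ?j" using net_separated assms by blast
    then have "c \<cdot> unit = c \<cdot> ?j" by simp
    then have "?t \<cdot> unit = ?t \<cdot> ?j" unfolding mul_left_cancel by simp
    then show False using k(1) by simp
  qed
  with k(2) j show ?thesis unfolding layer_def by (auto simp: mul_assoc)
qed

lemma near_net_unique:
  assumes "net (Suc n) c" "net (Suc n) d" "c \<cdot> i = d \<cdot> j" "i < near_bound n" "j < near_bound n"
  shows "c = d"
proof (rule net_separated[OF assms(1,2)])
  have "d = c \<cdot> i \<cdot> inverse_of j" unfolding assms(3) by (simp add: mul_assoc)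
  then have "inverse_of c \<cdot> d = i \<cdot> inverse_of j" by (simp add: mul_assoc)
  then show "close n c d" unfolding close_def separation_def using less_spread(3)[OF assms(4,5)] by simp
qed

subsection \<open>Writing a sequence\<close>

text \<open>On layer \<open>n\<close>, the flag tells that the point of the net \<open>n + 1\<close> nearby belongs to the net \<open>n + 2\<close>.\<close>

definition flag :: "nat \<Rightarrow> bool" where
  "flag g \<longleftrightarrow> g \<noteq> 0 \<and>
    (\<exists>j<near_bound (level g). net (Suc (Suc (level g))) (g \<cdot> inverse_of j))"

text \<open>The symbol has three bits: membership in the net \<open>1\<close>, from which recognition starts, then the flag,
  and then the entry of the sequence that belongs to the layer.\<close>

definition inscribe :: "(nat \<Rightarrow> nat) \<Rightarrow> nat \<Rightarrow> nat" where
  "inscribe y g = (if net 1 g then 1 else 0) + (if flag g then 2 else 0) +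
    4 * (if g = 0 then 0 else y (level g))"

text \<open>The next net is determined by the two nets before it and the flags. A flag near \<open>c\<close> cannot have been
  set for another point of the net \<open>n + 1\<close>, by \<open>near_net_unique\<close>.\<close>

lemma net_Suc_Suc_iff:
  "net (Suc (Suc n)) c \<longleftrightarrow> net (Suc n) c \<and> (\<exists>j<near_bound n. layer n (c \<cdot> j) \<and> flag (c \<cdot> j))"
proof
  assume c: "net (Suc (Suc n)) c"
  then have "net (Suc n) c" by (rule net_Suc)
  moreover from layer_near_net[OF this] obtain j where j: "j < near_bound n" "layer n (c \<cdot> j)" by blast
  moreover have "flag (c \<cdot> j)"
    using j c unfolding layer_iff flag_def by (auto simp: mul_assoc)
  ultimately show "net (Suc n) c \<and> (\<exists>j<near_bound n. layer n (c \<cdot> j) \<and> flag (c \<cdot> j))" by blast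
next
  assume "net (Suc n) c \<and> (\<exists>j<near_bound n. layer n (c \<cdot> j) \<and> flag (c \<cdot> j))"
  then obtain j i where c: "net (Suc n) c" and j: "j < near_bound n" and i: "i < near_bound n"
    and d: "net (Suc (Suc n)) (c \<cdot> j \<cdot> inverse_of i)"
    unfolding layer_iff flag_def by blast
  have "c = c \<cdot> j \<cdot> inverse_of i"
    by (rule near_net_unique[OF c net_Suc[OF d] _ j i]) (simp add: mul_assoc)
  with d show "net (Suc (Suc n)) c" by simp
qed

lemma computable_flag [comp_intros]: "computable f \<Longrightarrow> computable (\<lambda>x. flag (f x))"
  by (rule computable_compose[of flag]) (unfold flag_def, intro comp_intros)

lemma inscribe_cfunctional: "cfunctional {0, 1} {..<8} inscribe"
proof (rule cfunctionalI)
  show "computable (\<lambda>p. inscribe (nth_default 0 (snd p)) (fst p))"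
    unfolding inscribe_def by (intro comp_intros)
  show "computable Suc" by (intro comp_intros)
  show "inscribe y \<in> seqs {..<8}" if "y \<in> seqs {0, 1}" for y
  proof -
    have bit: "y i \<le> 1" for i using seqs_apply[OF that, of i] by auto
    have "inscribe y g < 8" for g
      using bit[of "level g"] unfolding inscribe_def by (auto split: if_splits)
    then show ?thesis by (auto simp: seqs_def)
  qed
  show "inscribe y g = inscribe (nth_default 0 (snd (g, map y [0..<Suc g]))) (fst (g, map y [0..<Suc g]))" for y g
    using level_le[of g] by (simp add: inscribe_def nth_default_map_upt del: upt_Suc)
qed

lemma odd_inscribe: "odd (inscribe y g) \<longleftrightarrow> net 1 g"
  and odd_half_inscribe: "odd (inscribe y g div 2) \<longleftrightarrow> flag g"
  by (auto simp: inscribe_def)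

lemma inscribe_div_4: "layer n g \<Longrightarrow> inscribe y g div 4 = y n"
  by (auto simp: inscribe_def layer_iff)

subsection \<open>Reading it back from any position\<close>

text \<open>The parts of the nets \<open>n\<close> and \<open>n + 1\<close> that are seen in the window \<open>u\<close>, by the recursion of
  \<open>net_Suc_Suc_iff\<close>. Positions outside the window count as lying outside the nets, so the lists are only
  meaningful in a smaller window, which shrinks at each step.\<close>

definition recognise :: "nat list \<Rightarrow> nat \<Rightarrow> bool list \<times> bool list" where
  "recognise u n = rec_nat
    (map (\<lambda>_. True) [0..<length u], map (\<lambda>i. odd (nth_default 0 u i)) [0..<length u])
    (\<lambda>n r. (snd r, map (\<lambda>i. nth_default False (snd r) i \<and> (\<exists>j<near_bound n.
        nth_default False (fst r) (i \<cdot> j) \<and> \<not> nth_default False (snd r) (i \<cdot> j) \<and>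
        odd (nth_default 0 u (i \<cdot> j) div 2))) [0..<length u]))
    n"

text \<open>The symbol at the first point of layer \<open>n\<close> that is recognised. If there is none, the search ends
  outside the word, where the default symbol \<open>0\<close> is read; this makes \<open>recover\<close> total.\<close>

definition recover_word :: "nat list \<Rightarrow> nat \<Rightarrow> nat" where
  "recover_word u n = nth_default 0 u (LEAST i. length u \<le> i \<or>
    (nth_default False (fst (recognise u n)) i \<and> \<not> nth_default False (snd (recognise u n)) i)) div 4"

text \<open>The nets \<open>n\<close> and \<open>n + 1\<close> must be recognised on an initial segment that contains a point of layer
  \<open>n\<close>: such a point is near a point of the net \<open>n + 1\<close>, which itself is within \<open>gap (Suc n)\<close>. Each of
  the \<open>n\<close> steps of recognition looks one \<open>spread\<close> further.\<close>

definition window :: "nat \<Rightarrow> nat" where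
  "window n = rec_nat (spread (gap (Suc n))) (\<lambda>_ r. spread r) n"

definition recover :: "(nat \<Rightarrow> nat) \<Rightarrow> nat \<Rightarrow> nat" where
  "recover x n = recover_word (map x [0..<window n]) n"

lemma computable_recognise [comp_intros]:
  assumes "computable f" "computable g" shows "computable (\<lambda>x. recognise (f x) (g x))"
proof -
  have "computable (\<lambda>p. recognise (fst p) (snd p))"
    unfolding recognise_def by (intro comp_intros)
  from computable_compose[OF this computable_pair[OF assms]] show ?thesis by simp
qed

lemma recover_cfunctional: "cfunctional {..<8} {0, 1} recover"
proof (rule cfunctionalI)
  show "computable (\<lambda>p. recover_word (snd p) (fst p))"
    unfolding recover_word_def by (intro comp_intros computable_Least) (rule exI, rule disjI1, rule order_refl)
  show "computable window"
    unfolding window_def by (intro comp_intros)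
  show "recover x \<in> seqs {0, 1}" if "x \<in> seqs {..<8}" for x
  proof -
    have "nth_default 0 (map x [0..<k]) i < 8" for k i
      using seqs_apply[OF that, of i] by (simp add: nth_default_map_upt)
    then have "nth_default 0 (map x [0..<k]) i div 4 < 2" for k i
      by (simp add: less_mult_imp_div_less)
    then have bit: "nth_default 0 (map x [0..<k]) i div 4 \<in> {0, 1}" for k i
      by (simp only: less_2_cases_iff insert_iff empty_iff simp_thms One_nat_def)
    show ?thesis unfolding seqs_def recover_def recover_word_def
      by (intro CollectI image_subsetI bit)
  qed
qed (simp add: recover_def)

text \<open>The window may be placed at any element \<open>g\<close>, since products from the right commute with translation
  from the left.\<close>

lemma recognise_correct:
  assumes u: "\<And>i. i < length u \<Longrightarrow> u ! i = inscribe y (g \<cdot> i)"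
    and "\<And>m. m < n \<Longrightarrow> near_bound m \<le> K" and "rec_nat K (\<lambda>_ r. spread r) n \<le> length u" and "i < K"
  shows "(nth_default False (fst (recognise u n)) i \<longleftrightarrow> net n (g \<cdot> i)) \<and>
    (nth_default False (snd (recognise u n)) i \<longleftrightarrow> net (Suc n) (g \<cdot> i))"
  using assms(2-)
proof (induction n arbitrary: K i)
  case 0
  then show ?case using u odd_inscribe
    by (simp add: recognise_def nth_default_map_upt net_0 nth_default_nth)
next
  case (Suc n)
  have step: "recognise u (Suc n) = (snd (recognise u n), map (\<lambda>i. nth_default False (snd (recognise u n)) i \<and> (\<exists>j<near_bound n.
        nth_default False (fst (recognise u n)) (i \<cdot> j) \<and> \<not> nth_default False (snd (recognise u n)) (i \<cdot> j) \<and>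
        odd (nth_default 0 u (i \<cdot> j) div 2))) [0..<length u])"
    by (simp add: recognise_def)
  have shift: "rec_nat (spread K) (\<lambda>_ r. spread r) n = rec_nat K (\<lambda>_ r. spread r) (Suc n)" for K
    by (induction n) auto
  have ge: "K \<le> rec_nat K (\<lambda>_ r. spread r) n" for K
    by (induction n) (auto intro: order_trans less_imp_le[OF spread_gt])
  have near: "near_bound n \<le> K" using Suc.prems(1) by blast
  have IH: "(nth_default False (fst (recognise u n)) i \<longleftrightarrow> net n (g \<cdot> i)) \<and>
    (nth_default False (snd (recognise u n)) i \<longleftrightarrow> net (Suc n) (g \<cdot> i))" if "i < spread K" for i
  proof (rule Suc.IH[OF _ _ that])
    show "near_bound m \<le> spread K" if "m < n" for m
      using Suc.prems(1)[of m] that spread_gt[of K] by simp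
    show "rec_nat (spread K) (\<lambda>_ r. spread r) n \<le> length u" unfolding shift by (rule Suc.prems)
  qed
  have len: "i < length u" if "i < spread K" for i
    using that ge[of "spread K"] Suc.prems(2) unfolding shift[symmetric] by linarith
  have i: "i < spread K" using Suc.prems(3) spread_gt[of K] by linarith
  have ij: "i \<cdot> j < spread K" if "j < near_bound n" for j
    using that near Suc.prems(3) by (intro less_spread(1)) auto
  have "nth_default False (snd (recognise u (Suc n))) i \<longleftrightarrow>
      net (Suc n) (g \<cdot> i) \<and> (\<exists>j<near_bound n. layer n (g \<cdot> i \<cdot> j) \<and> flag (g \<cdot> i \<cdot> j))"
  proof -
    have "nth_default False (fst (recognise u n)) (i \<cdot> j) \<and> \<not> nth_default False (snd (recognise u n)) (i \<cdot> j) \<and>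
        odd (nth_default 0 u (i \<cdot> j) div 2) \<longleftrightarrow> layer n (g \<cdot> i \<cdot> j) \<and> flag (g \<cdot> i \<cdot> j)"
      if "j < near_bound n" for j
      using IH[OF ij[OF that]] len[OF ij[OF that]] u odd_half_inscribe[of y "g \<cdot> (i \<cdot> j)"]
      by (simp add: layer_def mul_assoc nth_default_nth)
    then show ?thesis unfolding step using IH[OF i] len[OF i]
      by (simp add: nth_default_map_upt cong: conj_cong)
  qed
  then show ?case using IH[OF i] net_Suc_Suc_iff[of n "g \<cdot> i"] by (simp add: step)
qed

theorem recover_inscribe:
  assumes "y \<in> seqs {0, 1}"
  shows "recover (\<lambda>i. inscribe y (g \<cdot> i)) = y"
proof
  fix n
  let ?u = "map (\<lambda>i. inscribe y (g \<cdot> i)) [0..<window n]"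
  let ?K = "spread (gap (Suc n))"
  define found where "found i \<longleftrightarrow> nth_default False (fst (recognise ?u n)) i \<and>
    \<not> nth_default False (snd (recognise ?u n)) i" for i
  have K_window: "?K \<le> window n"
  proof -
    have "K \<le> rec_nat K (\<lambda>_ r. spread r) n" for K
      by (induction n) (auto intro: order_trans less_imp_le[OF spread_gt])
    then show ?thesis unfolding window_def .
  qed
  have found: "found i \<longleftrightarrow> layer n (g \<cdot> i)" if "i < ?K" for i
  proof -
    have near: "near_bound m \<le> ?K" if "m < n" for m
      using near_less_separation[of m] separation_less_gap[of m] gap_mono[of "Suc m" "Suc n"]
        spread_gt[of "gap (Suc n)"] that by linarith
    have "rec_nat ?K (\<lambda>_ r. spread r) n \<le> length ?u" by (simp add: window_def)
    from recognise_correct[OF _ near this that, of y g] show ?thesis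
      unfolding found_def layer_def by simp
  qed
  obtain k where k: "k < gap (Suc n)" "net (Suc n) (g \<cdot> k)" using net_gap by blast
  from layer_near_net[OF k(2)] obtain j where j: "j < near_bound n" "layer n (g \<cdot> k \<cdot> j)" by blast
  have "j < gap (Suc n)" using j(1) near_less_separation[of n] separation_less_gap[of n] by linarith
  with k(1) have kj: "k \<cdot> j < ?K" by (rule less_spread(1))
  let ?P = "\<lambda>i. length ?u \<le> i \<or> found i"
  have "found (k \<cdot> j)" using found[OF kj] j(2) by (simp add: mul_assoc)
  then have "?P (k \<cdot> j)" ..
  then have "(LEAST i. ?P i) \<le> k \<cdot> j" "?P (LEAST i. ?P i)" by (rule Least_le, rule LeastI)
  then have least: "(LEAST i. ?P i) < ?K" "found (LEAST i. ?P i)" using kj K_window by auto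
  then have "nth_default 0 ?u (LEAST i. ?P i) div 4 = y n"
    using found K_window inscribe_div_4 by (simp add: nth_default_map_upt)
  then show "recover (\<lambda>i. inscribe y (g \<cdot> i)) n = y n"
    unfolding recover_def recover_word_def found_def .
qed

end

section \<open>The degrees of effective subshifts\<close>

context numbered_group
begin

lemma delta_\<nu>_mul: "delta G \<nu> x (\<nu> k \<otimes> \<nu> i) = x (mul k i)"
  by (metis \<nu>_mul delta_\<nu>)

lemma delta_surj: "x \<in> carrier G \<rightarrow>\<^sub>E A \<Longrightarrow> delta G \<nu> (\<lambda>i. x (\<nu> i)) = x"
  unfolding delta_def by (rule extensionalityI[of _ "carrier G"])
    (auto simp: index_def[symmetric] PiE_def)

lemma effective_subshift_degree:
  assumes "finite A" "effective_subshift G S A X" "X \<noteq> {}"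
  shows "Pi01_degree (medvedev_degree (delta G \<nu> -` X))"
proof -
  obtain x where x: "x \<in> X" using assms(3) by blast
  then have "x \<in> carrier G \<rightarrow>\<^sub>E A"
    using assms(2) unfolding effective_subshift_def subshift_of_def by auto
  with x have "(\<lambda>i. x (\<nu> i)) \<in> delta G \<nu> -` X" by (simp add: delta_surj)
  then have "delta G \<nu> -` X \<noteq> {}" by blast
  from effectively_closed_binary_degree[OF assms(1)
      effective_subshift_vimage_effectively_closed[OF assms(1,2)] this]
  obtain P where "effectively_closed {0, 1} P" "P \<noteq> {}"
    "medvedev_degree (delta G \<nu> -` X) = medvedev_degree P" .
  then show ?thesis unfolding Pi01_degree_def by (intro exI[of _ P] conjI)
qed

text \<open>The subshift consists of the configurations all of whose translates are mapped into \<open>P\<close> by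
  \<^const>\<open>recover\<close>. Its reductions to and from \<open>P\<close> are \<^const>\<open>recover\<close> at the identity and
  \<^const>\<open>inscribe\<close>.\<close>

lemma degree_effective_subshift:
  assumes P: "effectively_closed {0, 1} P" "P \<noteq> {}"
  obtains X where "effective_subshift G S {..<8} X" "X \<noteq> {}"
    "medvedev_degree (delta G \<nu> -` X) = medvedev_degree P"
proof -
  have P_seqs: "P \<subseteq> seqs {0, 1}" using P(1) by (simp add: effectively_closed_def)
  define Q where "Q = {x \<in> seqs {..<8}. recover x \<in> P}"
  have "effectively_closed {..<8} Q"
    unfolding Q_def by (rule effectively_closed_vimage[OF recover_cfunctional _ P(1)]) simp
  then obtain L where L: "L \<subseteq> lists {..<8}" "comp_enumerable (list_encode ` L)"
    "seqs {..<8} - Q = (\<Union>v\<in>L. cylinder {..<8} v)"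
    unfolding effectively_closed_def by blast
  define X where "X = {x \<in> carrier G \<rightarrow>\<^sub>E {..<8}.
    \<forall>g\<in>carrier G. \<forall>v\<in>L. \<exists>i<length v. x (g \<otimes> \<nu> i) \<noteq> v ! i}"
  have X: "effective_subshift G S {..<8} X"
    unfolding X_def by (rule effective_subshift_of_words[OF L(1,2)])
  have Q_iff: "x \<in> Q \<longleftrightarrow> (\<forall>v\<in>L. \<exists>i<length v. x i \<noteq> v ! i)" if "x \<in> seqs {..<8}" for x
  proof -
    have "x \<in> Q \<longleftrightarrow> x \<notin> (\<Union>v\<in>L. cylinder {..<8} v)" unfolding L(3)[symmetric] using that by blast
    then show ?thesis using that by (auto simp: cylinder_def prefix_of_seq_iff)
  qed
  have carrier: "carrier G = range \<nu>" using bij_\<nu> by (simp add: bij_betw_def)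
  have vimage: "delta G \<nu> x \<in> X \<longleftrightarrow>
      x \<in> seqs {..<8} \<and> (\<forall>k. recover (\<lambda>i. x (mul k i)) \<in> P)" for x
  proof (cases "x \<in> seqs {..<8}")
    case True
    then have shifts: "(\<lambda>i. x (mul k i)) \<in> seqs {..<8}" for k by (auto simp: seqs_def)
    have "delta G \<nu> x \<in> X \<longleftrightarrow> (\<forall>k. \<forall>v\<in>L. \<exists>i<length v. x (mul k i) \<noteq> v ! i)"
      using True delta_PiE_iff[of x "{..<8}"] by (simp add: X_def carrier delta_\<nu>_mul del: lessThan_iff)
    also have "\<dots> \<longleftrightarrow> (\<forall>k. (\<lambda>i. x (mul k i)) \<in> Q)" using Q_iff[OF shifts] by simp
    finally show ?thesis using True shifts by (simp add: Q_def)
  next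
    case False
    then show ?thesis using delta_PiE_iff[of x "{..<8}"] by (auto simp: X_def)
  qed
  have inscribe_X: "delta G \<nu> (inscribe y) \<in> X" if "y \<in> P" for y
  proof -
    have "y \<in> seqs {0, 1}" using that P_seqs by blast
    then show ?thesis
      using cfunctional_seqs[OF inscribe_cfunctional] recover_inscribe that by (simp add: vimage)
  qed
  have recover_P: "recover x \<in> P" if "delta G \<nu> x \<in> X" for x
  proof -
    have "recover (\<lambda>i. x (mul (index \<one>) i)) \<in> P" using that vimage by blast
    then show ?thesis by simp
  qed
  have "medvedev_degree (delta G \<nu> -` X) = medvedev_degree P"
  proof (rule medvedev_degree_eqI)
    show "medvedev_le (delta G \<nu> -` X) P"
      by (rule medvedev_leI[OF inscribe_cfunctional]) (use P_seqs inscribe_X vimage in auto)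
    show "medvedev_le P (delta G \<nu> -` X)"
      by (rule medvedev_leI[OF recover_cfunctional]) (use P_seqs recover_P vimage in auto)
  qed
  moreover have "X \<noteq> {}" using P(2) inscribe_X by blast
  ultimately show ?thesis using that X by blast
qed

end

theorem theorem1p8:
  fixes G :: "('g, 'b) monoid_scheme" and S :: "'g set"
  assumes "group G" and "infinite (carrier G)"
    and "finite S" and "S \<subseteq> carrier G" and "generate G S = carrier G"
    and "decidable_word_problem G S"
  shows "{config_degree G X | A X. finite A \<and> effective_subshift G S A X \<and> X \<noteq> {}}
    = {d. Pi01_degree d}"
proof -
  interpret finitely_generated_group G S
    by (intro finitely_generated_group.intro finitely_generated_group_axioms.intro assms)
  define \<nu> where "\<nu> = (SOME \<nu>. computable_numbering G \<nu>)"
  have "computable_numbering G \<nu>"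
    unfolding \<nu>_def using computable_numbering_exists[OF assms(2,6)] by (rule someI_ex)
  then interpret numbered_group G S \<nu> by unfold_locales
  have degree: "config_degree G X = medvedev_degree (delta G \<nu> -` X)" for X
    unfolding config_degree_def \<nu>_def ..
  show ?thesis
  proof (intro equalityI subsetI)
    fix d assume "d \<in> {config_degree G X | A X. finite A \<and> effective_subshift G S A X \<and> X \<noteq> {}}"
    then show "d \<in> {d. Pi01_degree d}" using effective_subshift_degree degree by auto
  next
    fix d assume "d \<in> {d. Pi01_degree d}"
    then obtain P where "effectively_closed {0, 1} P" "P \<noteq> {}" and d: "d = medvedev_degree P"
      unfolding Pi01_degree_def by blast
    from this(1,2) obtain X where "effective_subshift G S {..<8} X" "X \<noteq> {}"
      "medvedev_degree (delta G \<nu> -` X) = medvedev_degree P"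
      by (rule degree_effective_subshift)
    then have "d = config_degree G X" "finite {..<8::nat}" by (simp_all add: d degree)
    then show "d \<in> {config_degree G X | A X. finite A \<and> effective_subshift G S A X \<and> X \<noteq> {}}"
      using \<open>effective_subshift G S {..<8} X\<close> \<open>X \<noteq> {}\<close> by blast
  qed
qed

end
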